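(* There is an absolute constant $\kappa>0$ such that for every prime $p$ and every $A\subset\mathbb{F}_p^*$ with $|A|\le p^{1/2-1/500}$, with $f(x,y)=xy(x+y)$, one has $$\max\big(|f(A,A)|,\,|A\cdot A|\big)\ge\kappa|A|^{1+1/800}.$$
   Context: $\mathbb{F}_p$ is the field with $p$ elements and $\mathbb{F}_p^*=\mathbb{F}_p\setminus\{0\}$. $f(A,A)=\{f(a,b): a,b\in A\}$ and $A\cdot A=\{ab: a,b\in A\}$. *)

theory Defs
  imports "HOL-Analysis.Analysis" "HOL-Number_Theory.Residues"
begin

definition image2 :: "('a \<Rightarrow> 'a \<Rightarrow> 'b) \<Rightarrow> 'a set \<Rightarrow> 'b set" where
  "image2 f A = {f a b | a b. a \<in> A \<and> b \<in> A}"

definition xy_sum :: "('a, 'm) ring_scheme \<Rightarrow> 'a \<Rightarrow> 'a \<Rightarrow> 'a" where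
  "xy_sum R x y = (x \<otimes>\<^bsub>R\<^esub> y) \<otimes>\<^bsub>R\<^esub> (x \<oplus>\<^bsub>R\<^esub> y)"

end

theory Submission
  imports Defs
begin

text \<open>
  Let \<open>N = |A|\<close> and suppose that \<open>A A\<close> and the set of values of \<open>f(x, y) = x y (x + y)\<close> on \<open>A\<close> both
  have at most \<open>K N\<close> elements. The claim follows from \<open>N \<le> C K\<^sup>6\<^sup>4\<^sup>3\<close> with an absolute constant \<open>C\<close>,
  because 643 is less than 800.

  The equation \<open>f(c, d) = v\<close> turns into multiplicative information about a set and about its
  translate by one. Some nonzero value \<open>v\<close> is taken by at least about \<open>N / K\<close> pairs \<open>(c, d)\<close>, and the
  ratio \<open>u = d / c\<close> of such a pair satisfies \<open>1 + u = (c + d) / c = v / (c c d)\<close>. A cube root has at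
  most three values, so a ratio arises from at most three pairs
  (\<open>exists_rich_value\<close>). Hence there is a set \<open>U\<close> of at least about \<open>N / K\<close> ratios that lies in
  \<open>A / A\<close> while \<open>1 + U\<close> lies in a dilate of \<open>1 / (A A A)\<close>. By the Pluennecke-Ruzsa inequality, all
  product and quotient sets built from \<open>U\<close> and \<open>1 + U\<close> have size at most a power of \<open>K\<close> times \<open>N\<close>
  (\<open>ratio_set_bounds\<close>).

  Such a \<open>U\<close> has additive structure too. If \<open>u w = u' w'\<close>, then
  \<open>u - u' = u (1 + w) - u' (1 + w')\<close> is a difference of two elements of the small set \<open>U (1 + U)\<close>.
  Since \<open>U / U\<close> is small, most pairs \<open>(u, u')\<close> admit many solutions \<open>(w, w')\<close>, so most pairs have
  a difference \<open>u - u'\<close> with many such representations, and only few such differences exist. Passing to the elements that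
  form popular pairs with most others gives a large \<open>B \<subseteq> U\<close> for which the whole difference set
  \<open>B - B\<close> is small (\<open>subset_with_small_differences\<close>). Here the usual Balog-Szemeredi-Gowers argument
  is easy because popularity depends on the ratio \<open>u / u'\<close> alone.

  A set \<open>B\<close> for which both \<open>B / B\<close> and \<open>B - B\<close> are small contradicts the sum-product phenomenon in a
  field of prime order, which is proved by the pivot method (\<open>sum_product_bound\<close>). For many \<open>a\<close> in
  \<open>B\<close> the dilate \<open>a B\<close> shares a large part with a fixed dilate \<open>b B\<close>, so it is covered by few
  translates of \<open>b B - b B\<close>. As 1 generates the additive group, one finds
  \<open>\<xi> = 1 + (a - b) / (c - d)\<close> with \<open>a, b, c, d\<close> among these elements such that \<open>x + \<xi> y\<close> takes almost as
  many values as there are pairs \<open>(x, y)\<close>. On the other hand \<open>(c - d) (x + \<xi> y)\<close> lies in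
  \<open>c B + c B + a B - d B - d B - b B\<close>, which is small by the covering.
\<close>

section \<open>Counting along the fibres of a map\<close>

lemma exists_large_fibre:
  assumes "finite X" "X \<noteq> {}"
  shows "\<exists>v\<in>f ` X. card X \<le> card (f ` X) * card {x \<in> X. f x = v}"
proof (rule ccontr)
  assume "\<not> ?thesis"
  hence small: "card (f ` X) * card {x \<in> X. f x = v} < card X" if "v \<in> f ` X" for v
    using that by (auto simp: not_le)
  have "card (f ` X) * card X = card (f ` X) * (\<Sum>v\<in>f ` X. card {x \<in> X. f x = v})"
    using sum_fun_comp[of X "f ` X" f "\<lambda>_. 1::nat"] assms by simp
  also have "\<dots> = (\<Sum>v\<in>f ` X. card (f ` X) * card {x \<in> X. f x = v})"
    by (simp add: sum_distrib_left)
  also have "\<dots> < (\<Sum>v\<in>f ` X. card X)"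
    using assms small by (intro sum_strict_mono) auto
  also have "\<dots> = card (f ` X) * card X" by simp
  finally show False by simp
qed

lemma card_le_card_image_times:
  assumes "finite X" "\<And>v. v \<in> f ` X \<Longrightarrow> real (card {x \<in> X. f x = v}) \<le> m"
  shows "real (card X) \<le> m * real (card (f ` X))"
proof -
  have "real (card X) = (\<Sum>v\<in>f ` X. real (card {x \<in> X. f x = v}))"
    using sum_fun_comp[of X "f ` X" f "\<lambda>_. 1::real"] assms by simp
  also have "\<dots> \<le> (\<Sum>v\<in>f ` X. m)" using assms(2) by (intro sum_mono) auto
  finally show ?thesis by (simp add: mult.commute)
qed

lemma card_image_times_le_card:
  assumes "finite X" "finite V" "\<And>v. v \<in> V \<Longrightarrow> m \<le> real (card {x \<in> X. f x = v})"
  shows "m * real (card V) \<le> real (card X)"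
proof -
  have "m * real (card V) = (\<Sum>v\<in>V. m)" by simp
  also have "\<dots> \<le> (\<Sum>v\<in>V. real (card {x \<in> X. f x = v}))"
    using assms(3) by (intro sum_mono) auto
  also have "\<dots> = real (card (\<Union>v\<in>V. {x \<in> X. f x = v}))"
    using assms by (subst card_UN_disjoint) auto
  also have "\<dots> \<le> real (card X)"
    using assms(1) by (intro of_nat_mono card_mono) auto
  finally show ?thesis .
qed

text \<open>
  Cauchy-Schwarz for the fibre sizes: a map with few collisions has a large image.
\<close>
lemma card_square_le_collisions:
  fixes f :: "'a \<Rightarrow> 'b"
  assumes "finite X"
  shows "(card X)\<^sup>2 \<le> card (f ` X) * card {z \<in> X \<times> X. f (fst z) = f (snd z)}"
proof -
  let ?k = "\<lambda>v. {x \<in> X. f x = v}"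
  have "real (card X) = (\<Sum>v\<in>f ` X. real (card (?k v)))"
    using sum_fun_comp[of X "f ` X" f "\<lambda>_. 1::real"] assms by simp
  hence "(real (card X))\<^sup>2 = (\<Sum>v\<in>f ` X. 1 * real (card (?k v)))\<^sup>2" by simp
  also have "\<dots> \<le> (\<Sum>v\<in>f ` X. 1\<^sup>2) * (\<Sum>v\<in>f ` X. (real (card (?k v)))\<^sup>2)"
    by (rule Cauchy_Schwarz_ineq_sum)
  also have "(\<Sum>v\<in>f ` X. (real (card (?k v)))\<^sup>2) = real (\<Sum>v\<in>f ` X. card (?k v \<times> ?k v))"
    by (simp add: card_cartesian_product power2_eq_square)
  also have "(\<Sum>v\<in>f ` X. card (?k v \<times> ?k v)) = card (\<Union>v\<in>f ` X. ?k v \<times> ?k v)"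
    using assms by (subst card_UN_disjoint) auto
  also have "(\<Union>v\<in>f ` X. ?k v \<times> ?k v) = {z \<in> X \<times> X. f (fst z) = f (snd z)}"
    by auto
  finally have "real ((card X)\<^sup>2) \<le> real (card (f ` X) * card {z \<in> X \<times> X. f (fst z) = f (snd z)})"
    by simp
  thus ?thesis by (simp only: of_nat_le_iff)
qed

section \<open>Product sets in an abelian group\<close>

lemma set_mult_image: "S <#>\<^bsub>G\<^esub> T = (\<lambda>(x, y). x \<otimes>\<^bsub>G\<^esub> y) ` (S \<times> T)"
  by (auto simp: set_mult_def)

lemma set_multI: "x \<in> S \<Longrightarrow> y \<in> T \<Longrightarrow> x \<otimes>\<^bsub>G\<^esub> y \<in> S <#>\<^bsub>G\<^esub> T"
  by (auto simp: set_mult_def)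

lemma set_multE:
  assumes "z \<in> S <#>\<^bsub>G\<^esub> T"
  obtains x y where "x \<in> S" "y \<in> T" "z = x \<otimes>\<^bsub>G\<^esub> y"
  using assms by (auto simp: set_mult_def)

lemma finite_set_mult [simp, intro]: "finite S \<Longrightarrow> finite T \<Longrightarrow> finite (S <#>\<^bsub>G\<^esub> T)"
  by (simp add: set_mult_image)

lemma card_set_mult_le:
  "finite S \<Longrightarrow> finite T \<Longrightarrow> card (S <#>\<^bsub>G\<^esub> T) \<le> card S * card T"
  unfolding set_mult_image by (metis card_cartesian_product card_image_le finite_cartesian_product)

text \<open>
  Both operations take the group as a record, so that the same notions give quotient sets in
  \<^term>\<open>mult_of R\<close> and difference sets in \<^term>\<open>add_monoid R\<close> for a field \<open>R\<close>.
\<close>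
definition set_div :: "('a, 'b) monoid_scheme \<Rightarrow> 'a set \<Rightarrow> 'a set \<Rightarrow> 'a set" where
  "set_div G S T = S <#>\<^bsub>G\<^esub> (m_inv G ` T)"

fun set_pow :: "('a, 'b) monoid_scheme \<Rightarrow> 'a set \<Rightarrow> nat \<Rightarrow> 'a set" where
  "set_pow G S 0 = {\<one>\<^bsub>G\<^esub>}"
| "set_pow G S (Suc n) = S <#>\<^bsub>G\<^esub> set_pow G S n"

lemma set_divI: "x \<in> S \<Longrightarrow> y \<in> T \<Longrightarrow> x \<otimes>\<^bsub>G\<^esub> m_inv G y \<in> set_div G S T"
  by (auto simp: set_div_def set_mult_def)

lemma set_divE:
  assumes "z \<in> set_div G S T"
  obtains x y where "x \<in> S" "y \<in> T" "z = x \<otimes>\<^bsub>G\<^esub> m_inv G y"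
  using assms by (auto simp: set_div_def set_mult_def)

lemma finite_set_div [simp, intro]: "finite S \<Longrightarrow> finite T \<Longrightarrow> finite (set_div G S T)"
  by (simp add: set_div_def)

lemma finite_set_pow [simp, intro]: "finite S \<Longrightarrow> finite (set_pow G S n)"
  by (induction n) auto

lemma set_div_mono: "S \<subseteq> S' \<Longrightarrow> T \<subseteq> T' \<Longrightarrow> set_div G S T \<subseteq> set_div G S' T'"
  by (auto simp: set_div_def set_mult_def)

context comm_group
begin

lemma set_div_closed: "S \<subseteq> carrier G \<Longrightarrow> T \<subseteq> carrier G \<Longrightarrow> set_div G S T \<subseteq> carrier G"
  by (auto simp: set_div_def set_mult_def)

lemma set_pow_closed: "S \<subseteq> carrier G \<Longrightarrow> set_pow G S n \<subseteq> carrier G"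
  by (induction n) (auto simp: set_mult_def)

lemma set_mult_one:
  assumes "S \<subseteq> carrier G"
  shows "S <#> {\<one>} = S" "{\<one>} <#> S = S"
proof -
  have "x \<otimes> \<one> = x" "\<one> \<otimes> x = x" if "x \<in> S" for x using that assms by auto
  thus "S <#> {\<one>} = S" "{\<one>} <#> S = S" by (simp_all add: set_mult_def)
qed

lemma set_pow_1: "S \<subseteq> carrier G \<Longrightarrow> set_pow G S (Suc 0) = S"
  by (simp add: set_mult_one)

lemma set_pow_add:
  assumes "S \<subseteq> carrier G"
  shows "set_pow G S (m + n) = set_pow G S m <#> set_pow G S n"
proof (induction m)
  case 0
  show ?case using set_pow_closed[OF assms, of n] by (simp add: set_mult_one)
next
  case (Suc m)
  show ?case using assms by (simp add: Suc set_mult_assoc set_pow_closed)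
qed

lemma mult_swap:
  assumes "a \<in> carrier G" "b \<in> carrier G" "c \<in> carrier G" "d \<in> carrier G"
  shows "(a \<otimes> b) \<otimes> (c \<otimes> d) = (a \<otimes> c) \<otimes> (b \<otimes> d)"
  using assms by (simp add: m_ac)

lemma card_mult_right:
  "x \<in> carrier G \<Longrightarrow> S \<subseteq> carrier G \<Longrightarrow> card ((\<lambda>y. y \<otimes> x) ` S) = card S"
  by (intro card_image inj_onI) (simp add: subset_iff)

lemma card_inv_image: "S \<subseteq> carrier G \<Longrightarrow> card (m_inv G ` S) = card S"
  by (intro card_image) (metis inv_inj inj_on_subset)

lemma card_le_card_set_mult:
  assumes "finite S" "finite T" "S \<subseteq> carrier G" "T \<subseteq> carrier G" "T \<noteq> {}"
  shows "card S \<le> card (S <#> T)"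
proof -
  obtain t where "t \<in> T" using assms by auto
  hence "(\<lambda>y. y \<otimes> t) ` S \<subseteq> S <#> T" by (auto simp: set_mult_def)
  thus ?thesis
    using assms \<open>t \<in> T\<close> card_mono[of "S <#> T" "(\<lambda>y. y \<otimes> t) ` S"] card_mult_right[of t S] by auto
qed

text \<open>
  Fix for every quotient \<open>d\<close> one way of writing it as \<open>y / z\<close>. The pair \<open>(x y, x z)\<close> then determines
  \<open>d\<close> as the ratio of its entries, hence \<open>y\<close>, and hence \<open>x\<close>.
\<close>
lemma ruzsa_triangle:
  assumes X: "finite X" "X \<subseteq> carrier G" and Y: "finite Y" "Y \<subseteq> carrier G"
    and Z: "finite Z" "Z \<subseteq> carrier G"
  shows "card X * card (set_div G Y Z) \<le> card (X <#> Y) * card (X <#> Z)"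
proof -
  let ?D = "set_div G Y Z"
  have "\<exists>y z. y \<in> Y \<and> z \<in> Z \<and> d = y \<otimes> inv z" if "d \<in> ?D" for d
  proof -
    from that obtain y z where "y \<in> Y" "z \<in> Z" "d = y \<otimes> inv z" by (rule set_divE)
    thus ?thesis by blast
  qed
  then obtain y z where yz: "\<And>d. d \<in> ?D \<Longrightarrow> y d \<in> Y \<and> z d \<in> Z \<and> d = y d \<otimes> inv (z d)"
    by metis
  define g where "g = (\<lambda>(x, d). (x \<otimes> y d, x \<otimes> z d))"
  have "inj_on g (X \<times> ?D)"
  proof (rule inj_onI, clarsimp simp: g_def)
    fix x d x' d'
    assume h: "x \<in> X" "d \<in> ?D" "x' \<in> X" "d' \<in> ?D" "x \<otimes> y d = x' \<otimes> y d'" "x \<otimes> z d = x' \<otimes> z d'"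
    have c: "x \<in> carrier G" "x' \<in> carrier G" "y d \<in> carrier G" "z d \<in> carrier G"
      "y d' \<in> carrier G" "z d' \<in> carrier G"
      using h X Y Z yz by auto
    have quot: "v \<otimes> inv w = (u \<otimes> v) \<otimes> inv (u \<otimes> w)"
      if "u \<in> carrier G" "v \<in> carrier G" "w \<in> carrier G" for u v w
  proof -
      have "(u \<otimes> v) \<otimes> inv (u \<otimes> w) = (u \<otimes> inv u) \<otimes> (v \<otimes> inv w)"
        unfolding inv_mult[OF that(1,3)] by (rule mult_swap) (use that in auto)
      thus ?thesis using that by simp
    qed
    have "d = y d \<otimes> inv (z d)" using yz[OF h(2)] by blast
    also have "\<dots> = (x \<otimes> y d) \<otimes> inv (x \<otimes> z d)" by (rule quot) (use c in auto)
    also have "\<dots> = (x' \<otimes> y d') \<otimes> inv (x' \<otimes> z d')" using h by simp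
    also have "\<dots> = y d' \<otimes> inv (z d')" by (rule quot[symmetric]) (use c in auto)
    also have "\<dots> = d'" using yz[OF h(4)] by simp
    finally have "d = d'" .
    thus "x = x' \<and> d = d'" using h(5) c by simp
  qed
  moreover have "g ` (X \<times> ?D) \<subseteq> (X <#> Y) \<times> (X <#> Z)"
    using yz by (auto simp: g_def intro!: set_multI)
  ultimately have "card (X \<times> ?D) \<le> card ((X <#> Y) \<times> (X <#> Z))"
    using X Y Z by (intro card_inj_on_le[of g]) auto
  thus ?thesis by (simp add: card_cartesian_product)
qed

text \<open>
  Petridis' lemma: \<open>X\<close> is a nonempty subset of \<open>A\<close> with the least expansion ratio \<open>|X B| / |X|\<close>, and the
  elements of \<open>C\<close> are added one at a time. The new element \<open>c\<close> contributes to \<open>X C\<close> the translates by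
  \<open>c\<close> of the elements outside some \<open>Y \<subseteq> X\<close>; to \<open>X B C\<close> it contributes at most
  \<open>|X B| - |Y B|\<close> elements, and minimality bounds \<open>|Y B|\<close> from below.
\<close>
lemma petridis:
  assumes A: "finite A" "A \<subseteq> carrier G" "A \<noteq> {}" and B: "finite B" "B \<subseteq> carrier G"
    and K: "real (card (A <#> B)) \<le> K * real (card A)"
  shows "\<exists>X. X \<subseteq> A \<and> X \<noteq> {} \<and> (\<forall>C. finite C \<longrightarrow> C \<subseteq> carrier G \<longrightarrow>
           real (card (X <#> B <#> C)) \<le> K * real (card (X <#> C)))"
proof -
  define ratio where "ratio = (\<lambda>Y. real (card (Y <#> B)) / real (card Y))"
  define P where "P = Pow A - {{}}"
  have "finite P" "P \<noteq> {}" using A by (auto simp: P_def)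
  then obtain X where X: "X \<in> P" "\<And>Y. Y \<in> P \<Longrightarrow> ratio X \<le> ratio Y"
    using arg_min_if_finite[of P ratio] by (metis arg_min_least)
  hence XA: "X \<subseteq> A" "X \<noteq> {}" and fX: "finite X" and cX: "X \<subseteq> carrier G"
    using A by (auto simp: P_def intro: finite_subset)
  define k where "k = ratio X"
  have kX: "real (card (X <#> B)) = k * real (card X)"
    using XA fX by (simp add: k_def ratio_def)
  have kY: "k * real (card Y) \<le> real (card (Y <#> B))" if "Y \<subseteq> X" for Y
  proof (cases "Y = {}")
    case False
    hence "Y \<in> P" "finite Y" using that XA fX by (auto simp: P_def intro: finite_subset)
    hence "k \<le> real (card (Y <#> B)) / real (card Y)"
      using X(2)[of Y] unfolding k_def ratio_def by blast
    moreover have "card Y > 0" using \<open>finite Y\<close> False by (simp add: card_gt_0_iff)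
    ultimately show ?thesis by (metis of_nat_0_less_iff pos_le_divide_eq)
  qed auto
  have "k \<le> ratio A" using X(2)[of A] A by (auto simp: P_def k_def)
  also have "\<dots> \<le> K"
  proof -
    have "card A > 0" using A by (simp add: card_gt_0_iff)
    thus ?thesis using K by (simp add: ratio_def divide_le_eq)
  qed
  finally have kK: "k \<le> K" .
  have "real (card (X <#> B <#> C)) \<le> k * real (card (X <#> C))"
    if "finite C" "C \<subseteq> carrier G" for C
    using that
  proof (induction C rule: finite_induct)
    case (insert c C)
    hence c: "c \<in> carrier G" and cC: "C \<subseteq> carrier G"
      and IH: "real (card (X <#> B <#> C)) \<le> k * real (card (X <#> C))" by auto
    define Y where "Y = {x \<in> X. x \<otimes> c \<in> X <#> C}"
    have YX: "Y \<subseteq> X" by (auto simp: Y_def)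
    have fY: "finite Y" using fX YX finite_subset by blast
    have XBc: "X <#> B \<subseteq> carrier G" using cX B by (simp add: set_mult_closed)
    have YBX: "Y <#> B \<subseteq> X <#> B" using YX by (auto simp: set_mult_def)
    let ?t = "\<lambda>S. (\<lambda>x. x \<otimes> c) ` S"
    have split1: "X <#> insert c C = (X <#> C) \<union> ?t (X - Y)"
      by (auto simp: set_mult_def Y_def)
    have "(X <#> C) \<inter> ?t (X - Y) = {}" by (auto simp: Y_def)
    hence "card (X <#> insert c C) = card (X <#> C) + card (?t (X - Y))"
      unfolding split1 using fX insert by (intro card_Un_disjoint) auto
    also have "card (?t (X - Y)) = card (X - Y)" using c cX by (intro card_mult_right) auto
    also have "\<dots> = card X - card Y" using fY YX by (rule card_Diff_subset)
    finally have e1: "real (card (X <#> insert c C)) = real (card (X <#> C)) + (real (card X) - real (card Y))"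
      using card_mono[OF fX YX] by simp
    have "X <#> B <#> insert c C \<subseteq> (X <#> B <#> C) \<union> ?t ((X <#> B) - (Y <#> B))"
    proof
      fix w assume "w \<in> X <#> B <#> insert c C"
      then obtain s e where se: "s \<in> X <#> B" "e \<in> insert c C" "w = s \<otimes> e" by (rule set_multE)
      show "w \<in> (X <#> B <#> C) \<union> ?t ((X <#> B) - (Y <#> B))"
      proof (cases "e \<in> C")
        case True thus ?thesis using se by (auto intro: set_multI)
      next
        case False
        hence w: "w = s \<otimes> c" using se by auto
        show ?thesis
        proof (cases "s \<in> Y <#> B")
          case True
          then obtain y b where yb: "y \<in> Y" "b \<in> B" "s = y \<otimes> b" by (rule set_multE)
          then have "y \<otimes> c \<in> X <#> C" by (simp add: Y_def)
          then obtain x c' where xc: "x \<in> X" "c' \<in> C" "y \<otimes> c = x \<otimes> c'"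
            by (rule set_multE)
          have cl: "y \<in> carrier G" "b \<in> carrier G" "x \<in> carrier G" "c' \<in> carrier G"
            using yb xc YX cX B cC by auto
          have "w = (y \<otimes> c) \<otimes> b" using w yb cl c by (simp add: m_ac)
          also have "\<dots> = (x \<otimes> b) \<otimes> c'" using xc cl by (simp add: m_ac)
          finally show ?thesis using xc yb by (auto intro!: set_multI)
        next
          case False thus ?thesis using w se by auto
        qed
      qed
    qed
    hence "card (X <#> B <#> insert c C) \<le> card ((X <#> B <#> C) \<union> ?t ((X <#> B) - (Y <#> B)))"
      using fX B insert by (intro card_mono) auto
    also have "\<dots> \<le> card (X <#> B <#> C) + card (?t ((X <#> B) - (Y <#> B)))" by (rule card_Un_le)
    also have "card (?t ((X <#> B) - (Y <#> B))) = card ((X <#> B) - (Y <#> B))"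
      using c XBc by (intro card_mult_right) auto
    also have "\<dots> = card (X <#> B) - card (Y <#> B)"
      using fY B YBX by (intro card_Diff_subset) auto
    finally have "real (card (X <#> B <#> insert c C)) \<le>
        real (card (X <#> B <#> C)) + (real (card (X <#> B)) - real (card (Y <#> B)))"
      using card_mono[OF _ YBX] fX B by simp
    also have "\<dots> \<le> k * real (card (X <#> C)) + (k * real (card X) - k * real (card Y))"
      using IH kX kY[OF YX] by simp
    also have "\<dots> = k * real (card (X <#> insert c C))"
      unfolding e1 by (simp add: algebra_simps)
    finally show ?case .
  qed (auto simp: set_mult_def)
  moreover have "k * real (card (X <#> C)) \<le> K * real (card (X <#> C))" for C
    using kK by (intro mult_right_mono) auto
  ultimately show ?thesis using XA by (meson order_trans)
qed

text \<open>
  Iterating Petridis' lemma with \<open>C\<close> a power of \<open>B\<close> controls \<open>X B\<^sup>m\<close> and \<open>X B\<^sup>n\<close>; the triangle inequality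
  removes \<open>X\<close>.
\<close>
lemma pluennecke_ruzsa:
  assumes A: "finite A" "A \<subseteq> carrier G" "A \<noteq> {}" and B: "finite B" "B \<subseteq> carrier G"
    and K: "real (card (A <#> B)) \<le> K * real (card A)"
  shows "real (card (set_div G (set_pow G B m) (set_pow G B n))) \<le> K ^ (m + n) * real (card A)"
proof -
  obtain X where X: "X \<subseteq> A" "X \<noteq> {}"
    and step: "\<And>C. finite C \<Longrightarrow> C \<subseteq> carrier G \<Longrightarrow>
           real (card (X <#> B <#> C)) \<le> K * real (card (X <#> C))"
    using petridis[OF A B K] by blast
  have fX: "finite X" and cX: "X \<subseteq> carrier G" using X A finite_subset by auto
  have "0 \<le> K * real (card A)" using K by (meson of_nat_0_le_iff order_trans)
  hence K0: "K \<ge> 0" using A by (simp add: zero_le_mult_iff card_gt_0_iff)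
  have grow: "real (card (X <#> set_pow G B j)) \<le> K ^ j * real (card X)" for j
  proof (induction j)
    case 0
    show ?case using cX by (simp add: set_mult_one)
  next
    case (Suc j)
    have "X <#> set_pow G B (Suc j) = X <#> B <#> set_pow G B j"
      using cX B by (simp add: set_mult_assoc set_pow_closed)
    hence "real (card (X <#> set_pow G B (Suc j))) \<le> K * real (card (X <#> set_pow G B j))"
      using step[of "set_pow G B j"] B set_pow_closed by auto
    also have "\<dots> \<le> K * (K ^ j * real (card X))" using Suc K0 by (intro mult_left_mono)
    finally show ?case by simp
  qed
  have "real (card X) * real (card (set_div G (set_pow G B m) (set_pow G B n)))
      \<le> real (card (X <#> set_pow G B m)) * real (card (X <#> set_pow G B n))"
    using ruzsa_triangle[OF fX cX, of "set_pow G B m" "set_pow G B n"] B set_pow_closed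
    by (simp flip: of_nat_mult)
  also have "\<dots> \<le> (K ^ m * real (card X)) * (K ^ n * real (card X))"
    using K0 by (intro mult_mono grow) auto
  also have "\<dots> = real (card X) * (K ^ (m + n) * real (card X))"
    by (simp add: power_add)
  finally have "real (card (set_div G (set_pow G B m) (set_pow G B n))) \<le> K ^ (m + n) * real (card X)"
    using X fX by (simp add: card_gt_0_iff)
  also have "\<dots> \<le> K ^ (m + n) * real (card A)"
    using K0 X A by (intro mult_left_mono) (auto intro: card_mono)
  finally show ?thesis .
qed

end

section \<open>Popular quotients and coverings\<close>

text \<open>
  The map \<open>w \<mapsto> u w\<close> identifies this set with the intersection of the dilates \<open>u U\<close> and \<open>v U\<close>. Its
  size is the number of ways to write \<open>u / v\<close> as a quotient of two elements of \<open>U\<close>.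
\<close>
definition overlap :: "('a, 'b) monoid_scheme \<Rightarrow> 'a set \<Rightarrow> 'a \<Rightarrow> 'a \<Rightarrow> 'a set" where
  "overlap G U u v = {w \<in> U. \<exists>w'\<in>U. u \<otimes>\<^bsub>G\<^esub> w = v \<otimes>\<^bsub>G\<^esub> w'}"

text \<open>
  The exponent \<open>n\<close> counts both the factors \<open>q\<close> and the factors \<open>D\<close>, so that it adds up when sets are
  multiplied.
\<close>
definition covered :: "('a, 'b) monoid_scheme \<Rightarrow> 'a set \<Rightarrow> real \<Rightarrow> nat \<Rightarrow> 'a set \<Rightarrow> bool" where
  "covered G D q n S \<longleftrightarrow> (\<exists>X. finite X \<and> X \<subseteq> carrier G \<and> real (card X) \<le> q ^ n \<and>
     S \<subseteq> X <#>\<^bsub>G\<^esub> set_pow G D n)"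

lemma finite_overlap [simp, intro]: "finite U \<Longrightarrow> finite (overlap G U u v)"
  by (simp add: overlap_def)

context comm_group
begin

text \<open>
  Group the unpopular pairs by their quotient: the pairs with the same quotient as \<open>(u, v)\<close> embed into
  the overlap of \<open>u\<close> and \<open>v\<close>, so each of the at most \<open>|U / U|\<close> groups has fewer than \<open>m\<close> members.
\<close>
lemma few_unpopular_pairs:
  assumes U: "finite U" "U \<subseteq> carrier G" and m: "m \<ge> 0"
  shows "real (card {z \<in> U \<times> U. real (card (overlap G U (fst z) (snd z))) < m})
         \<le> m * real (card (set_div G U U))"
proof -
  let ?X = "{z \<in> U \<times> U. real (card (overlap G U (fst z) (snd z))) < m}"
  let ?f = "\<lambda>z. fst z \<otimes> inv (snd z)"
  have "real (card {z \<in> ?X. ?f z = r}) \<le> m" if "r \<in> ?f ` ?X" for r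
  proof -
    obtain z0 where z0: "z0 \<in> ?X" "r = ?f z0" using \<open>r \<in> ?f ` ?X\<close> by blast
    define u v where "u = fst z0" and "v = snd z0"
    have uv: "u \<in> U" "v \<in> U" "real (card (overlap G U u v)) < m" "r = u \<otimes> inv v"
      using z0 by (auto simp: u_def v_def)
    have uvc: "u \<in> carrier G" "v \<in> carrier G" using uv U by auto
    have cross: "fst z \<otimes> v = u \<otimes> snd z" "snd z \<in> U" "fst z \<in> U" if z: "z \<in> {z \<in> ?X. ?f z = r}" for z
    proof -
      have zc: "fst z \<in> carrier G" "snd z \<in> carrier G" using z U by auto
      have "fst z = (u \<otimes> inv v) \<otimes> snd z"
      proof -
        have "u \<otimes> inv v = fst z \<otimes> inv (snd z)" using z uv by auto
        thus ?thesis using zc uvc inv_solve_right[of "u \<otimes> inv v" "fst z" "snd z"] by simp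
      qed
      hence "fst z \<otimes> v = (u \<otimes> snd z) \<otimes> (inv v \<otimes> v)"
        using zc uvc by (simp add: m_ac del: l_inv r_inv Units_l_inv Units_r_inv)
      thus "fst z \<otimes> v = u \<otimes> snd z" using zc uvc by simp
    qed (use z in auto)
    have "inj_on snd {z \<in> ?X. ?f z = r}"
    proof (rule inj_onI)
      fix z z' assume z: "z \<in> {z \<in> ?X. ?f z = r}" "z' \<in> {z \<in> ?X. ?f z = r}" "snd z = snd z'"
      have "fst z \<otimes> v = fst z' \<otimes> v" using cross[OF z(1)] cross[OF z(2)] z(3) by simp
      moreover have "fst z \<in> carrier G" "fst z' \<in> carrier G"
        using cross(3)[OF z(1)] cross(3)[OF z(2)] U by auto
      ultimately have "fst z = fst z'" using uvc by simp
      thus "z = z'" using z(3) by (simp add: prod_eq_iff)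
    qed
    moreover have "snd ` {z \<in> ?X. ?f z = r} \<subseteq> overlap G U u v"
    proof
      fix w assume "w \<in> snd ` {z \<in> ?X. ?f z = r}"
      then obtain z where z: "z \<in> {z \<in> ?X. ?f z = r}" "w = snd z" by blast
      have "fst z \<in> carrier G" using cross(3)[OF z(1)] U by blast
      hence "u \<otimes> w = v \<otimes> fst z" using cross(1)[OF z(1)] z(2) uvc m_comm[of "fst z" v] by simp
      thus "w \<in> overlap G U u v" using cross[OF z(1)] z(2) by (auto simp: overlap_def)
    qed
    ultimately have "card {z \<in> ?X. ?f z = r} \<le> card (overlap G U u v)"
      using U by (intro card_inj_on_le[of snd]) auto
    thus ?thesis using uv by linarith
  qed
  hence "real (card ?X) \<le> m * real (card (?f ` ?X))"
    using U by (intro card_le_card_image_times) auto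
  also have "\<dots> \<le> m * real (card (set_div G U U))"
    using U m by (intro mult_left_mono of_nat_mono card_mono) (auto intro: set_divI)
  finally show ?thesis .
qed

text \<open>
  The threshold \<open>m\<close> is chosen so that at most a sixteenth of all pairs are unpopular. At most a
  quarter of the elements can then have more than a quarter of their pairs unpopular. The proportion
  3/4 matters later: any two elements of \<open>U'\<close> share at least half of \<open>U\<close> as popular partners.
\<close>
lemma popular_quotients:
  assumes U: "finite U" "U \<subseteq> carrier G" and D: "real (card (set_div G U U)) \<le> D" "D > 0"
    and m: "m = (real (card U))\<^sup>2 / (16 * D)"
  shows "\<exists>U'\<subseteq>U. 3 / 4 * real (card U) \<le> real (card U') \<and>
    (\<forall>u\<in>U'. 3 / 4 * real (card U) \<le> real (card {v \<in> U. m \<le> real (card (overlap G U u v))}))"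
proof (cases "U = {}")
  case False
  let ?n = "real (card U)"
  let ?bad = "{z \<in> U \<times> U. real (card (overlap G U (fst z) (snd z))) < m}"
  let ?g = "\<lambda>u. {v \<in> U. m \<le> real (card (overlap G U u v))}"
  let ?b = "\<lambda>u. {v \<in> U. real (card (overlap G U u v)) < m}"
  define U' where "U' = {u \<in> U. 3 / 4 * ?n \<le> real (card (?g u))}"
  have n0: "?n > 0" using U False by (simp add: card_gt_0_iff)
  have "real (card ?bad) \<le> m * real (card (set_div G U U))"
    using few_unpopular_pairs[OF U, of m] m D by simp
  also have "\<dots> \<le> m * D" using D m by (intro mult_left_mono) auto
  also have "\<dots> = ?n\<^sup>2 / 16" using D m by simp
  finally have few: "real (card ?bad) \<le> ?n\<^sup>2 / 16" .
  have "?n / 4 * real (card (U - U')) \<le> real (card ?bad)"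
  proof (rule card_image_times_le_card[where f = fst])
    fix u assume u: "u \<in> U - U'"
    have "card (?g u \<union> ?b u) = card (?g u) + card (?b u)"
      using U by (intro card_Un_disjoint) auto
    moreover have "?g u \<union> ?b u = U" by auto
    moreover have "card {z \<in> ?bad. fst z = u} = card (?b u)"
    proof -
      have "{z \<in> ?bad. fst z = u} = Pair u ` ?b u" using u by auto
      thus ?thesis by (simp add: card_image inj_on_def)
    qed
    ultimately show "?n / 4 \<le> real (card {z \<in> ?bad. fst z = u})"
      using u by (auto simp: U'_def not_le)
  qed (use U in auto)
  hence "?n * real (card (U - U')) \<le> ?n * (?n / 4)" using few by (simp add: power2_eq_square)
  hence "real (card (U - U')) \<le> ?n / 4" using n0 by (subst (asm) mult_le_cancel_left_pos) auto
  moreover have "U' \<subseteq> U" by (auto simp: U'_def)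
  moreover have "real (card (U - U')) = ?n - real (card U')"
    using U \<open>U' \<subseteq> U\<close> by (simp add: card_Diff_subset finite_subset card_mono of_nat_diff)
  ultimately show ?thesis by (intro exI[of _ U']) (auto simp: U'_def)
qed auto

text \<open>
  Take a maximal \<open>X \<subseteq> S\<close> for which the translates of \<open>1 / T\<close> by elements of \<open>X\<close> are disjoint. They fit
  into \<open>S / T\<close>, which bounds \<open>|X|\<close>, and by maximality the translate by any \<open>s\<close> in \<open>S\<close> meets one of
  them.
\<close>
lemma ruzsa_covering:
  assumes S: "finite S" "S \<subseteq> carrier G" and T: "finite T" "T \<subseteq> carrier G" "T \<noteq> {}"
  shows "\<exists>X\<subseteq>S. card X * card T \<le> card (set_div G S T) \<and> S \<subseteq> X <#> set_div G T T"
proof -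
  let ?f = "\<lambda>(x, t). x \<otimes> inv t"
  define P where "P = {X. X \<subseteq> S \<and> inj_on ?f (X \<times> T)}"
  have "P \<subseteq> Pow S" by (auto simp: P_def)
  hence fin: "finite P" using S by (meson finite_Pow_iff finite_subset)
  have "{} \<in> P" by (simp add: P_def)
  hence "Max (card ` P) \<in> card ` P" using fin by (intro Max_in) auto
  then obtain X where "X \<in> P" "card X = Max (card ` P)" by auto
  hence X: "X \<in> P" "\<And>Y. Y \<in> P \<Longrightarrow> card Y \<le> card X" using fin by auto
  have XS: "X \<subseteq> S" and inj: "inj_on ?f (X \<times> T)" using X by (auto simp: P_def)
  have fX: "finite X" using XS S finite_subset by blast
  have "?f ` (X \<times> T) \<subseteq> set_div G S T" using XS by (auto intro: set_divI)
  hence "card (X \<times> T) \<le> card (set_div G S T)"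
    using inj S T by (intro card_inj_on_le[of ?f]) auto
  moreover have "s \<in> X <#> set_div G T T" if s: "s \<in> S" for s
  proof -
    have sc: "s \<in> carrier G" using s S by auto
    have "\<exists>x\<in>X. \<exists>t\<in>T. \<exists>t'\<in>T. s \<otimes> inv t = x \<otimes> inv t'"
    proof (rule ccontr)
      assume neg: "\<not> ?thesis"
      hence "s \<notin> X" using T by blast
      have "inj_on ?f (insert s X \<times> T)"
      proof (rule inj_onI, clarify)
        fix x t x' t'
        assume h: "x \<in> insert s X" "t \<in> T" "x' \<in> insert s X" "t' \<in> T" "x \<otimes> inv t = x' \<otimes> inv t'"
        have tc: "t \<in> carrier G" "t' \<in> carrier G" using h T by auto
        consider "x \<in> X" "x' \<in> X" | "x = s" "x' = s" | "x = s" "x' \<in> X" | "x \<in> X" "x' = s" using h by auto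
        thus "x = x' \<and> t = t'"
        proof cases
          case 1
          thus ?thesis using inj_onD[OF inj, of "(x, t)" "(x', t')"] h by auto
        next
          case 2
          hence "inv t = inv t'" using h(5) sc tc by simp
          hence "t = t'" using tc by (metis inv_inv)
          thus ?thesis using 2 by simp
        next
          case 3 thus ?thesis using neg h by metis
        next
          case 4 thus ?thesis using neg h by metis
        qed
      qed
      hence "insert s X \<in> P" using XS s by (simp add: P_def)
      from X(2)[OF this] show False using \<open>s \<notin> X\<close> fX by simp
    qed
    then obtain x t t' where xt: "x \<in> X" "t \<in> T" "t' \<in> T" "s \<otimes> inv t = x \<otimes> inv t'" by blast
    have c: "x \<in> carrier G" "t \<in> carrier G" "t' \<in> carrier G" using xt XS S T by auto
    have "s = (s \<otimes> inv t) \<otimes> t" using sc c by (simp add: m_assoc)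
    also have "\<dots> = x \<otimes> (t \<otimes> inv t')" using c by (simp add: xt(4) m_ac)
    finally show ?thesis using xt by (auto intro!: set_multI set_divI)
  qed
  ultimately show ?thesis using XS by (intro exI[of _ X]) (auto simp: card_cartesian_product)
qed

lemma covered_mult:
  assumes D: "D \<subseteq> carrier G" and S: "covered G D q m S" and T: "covered G D q n T" and q: "q \<ge> 0"
  shows "covered G D q (m + n) (S <#> T)"
proof -
  obtain X where X: "finite X" "X \<subseteq> carrier G" "real (card X) \<le> q ^ m" "S \<subseteq> X <#> set_pow G D m"
    using S by (auto simp: covered_def)
  obtain Y where Y: "finite Y" "Y \<subseteq> carrier G" "real (card Y) \<le> q ^ n" "T \<subseteq> Y <#> set_pow G D n"
    using T by (auto simp: covered_def)
  have "real (card (X <#> Y)) \<le> real (card X) * real (card Y)"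
    using card_set_mult_le[OF X(1) Y(1)] by (simp flip: of_nat_mult)
  also have "\<dots> \<le> q ^ m * q ^ n" using X Y q by (intro mult_mono) auto
  finally have "real (card (X <#> Y)) \<le> q ^ (m + n)" by (simp add: power_add)
  moreover have "S <#> T \<subseteq> (X <#> Y) <#> set_pow G D (m + n)"
  proof
    fix w assume "w \<in> S <#> T"
    then obtain s t where st: "s \<in> S" "t \<in> T" "w = s \<otimes> t" by (rule set_multE)
    have "s \<in> X <#> set_pow G D m" using st X by blast
    then obtain x d where xd: "x \<in> X" "d \<in> set_pow G D m" "s = x \<otimes> d" by (rule set_multE)
    have "t \<in> Y <#> set_pow G D n" using st Y by blast
    then obtain y e where ye: "y \<in> Y" "e \<in> set_pow G D n" "t = y \<otimes> e" by (rule set_multE)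
    have "w = (x \<otimes> y) \<otimes> (d \<otimes> e)"
      unfolding st xd ye by (rule mult_swap) (use xd ye X Y set_pow_closed[OF D] in blast)+
    thus "w \<in> (X <#> Y) <#> set_pow G D (m + n)"
      using xd ye by (auto simp: set_pow_add[OF D] intro!: set_multI)
  qed
  moreover have "X <#> Y \<subseteq> carrier G" using X Y by (simp add: set_mult_closed)
  ultimately show ?thesis using X Y unfolding covered_def by blast
qed

lemma set_pow_inv:
  assumes D: "D \<subseteq> carrier G" "\<And>d. d \<in> D \<Longrightarrow> inv d \<in> D"
  shows "d \<in> set_pow G D n \<Longrightarrow> inv d \<in> set_pow G D n"
proof (induction n arbitrary: d)
  case (Suc n)
  from Suc.prems obtain x y where xy: "x \<in> D" "y \<in> set_pow G D n" "d = x \<otimes> y"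
    unfolding set_pow.simps by (rule set_multE)
  hence "inv d = inv x \<otimes> inv y" using D(1) set_pow_closed[OF D(1), of n] by (auto intro!: inv_mult)
  thus ?case using xy Suc.IH D(2) by (auto intro!: set_multI)
qed auto

lemma covered_inv:
  assumes D: "D \<subseteq> carrier G" "\<And>d. d \<in> D \<Longrightarrow> inv d \<in> D" and S: "covered G D q n S"
  shows "covered G D q n (m_inv G ` S)"
proof -
  obtain X where X: "finite X" "X \<subseteq> carrier G" "real (card X) \<le> q ^ n" "S \<subseteq> X <#> set_pow G D n"
    using S by (auto simp: covered_def)
  have "m_inv G ` S \<subseteq> (m_inv G ` X) <#> set_pow G D n"
  proof
    fix w assume "w \<in> m_inv G ` S"
    then obtain s where s: "w = inv s" "s \<in> X <#> set_pow G D n" using X by blast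
    from s(2) obtain x d where xd: "x \<in> X" "d \<in> set_pow G D n" "s = x \<otimes> d" by (rule set_multE)
    hence "w = inv x \<otimes> inv d" using s(1) X set_pow_closed[OF D(1), of n] by (auto intro!: inv_mult)
    thus "w \<in> (m_inv G ` X) <#> set_pow G D n"
      using xd set_pow_inv[OF D] by (auto intro!: set_multI)
  qed
  moreover have "card (m_inv G ` X) = card X" by (rule card_inv_image[OF X(2)])
  ultimately show ?thesis using X unfolding covered_def
    by (intro exI[of _ "m_inv G ` X"]) auto
qed

lemma card_covered_le:
  assumes "finite D" "covered G D q n S"
  shows "real (card S) \<le> q ^ n * real (card (set_pow G D n))"
proof -
  obtain X where X: "finite X" "real (card X) \<le> q ^ n" "S \<subseteq> X <#> set_pow G D n"
    using assms by (auto simp: covered_def)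
  have "card S \<le> card (X <#> set_pow G D n)" using X assms by (intro card_mono) auto
  also have "\<dots> \<le> card X * card (set_pow G D n)" using X assms by (intro card_set_mult_le) auto
  finally have "real (card S) \<le> real (card X) * real (card (set_pow G D n))"
    by (simp flip: of_nat_mult)
  also have "\<dots> \<le> q ^ n * real (card (set_pow G D n))" using X by (intro mult_right_mono) auto
  finally show ?thesis .
qed

text \<open>
  The role of \<open>A\<close> in \<open>pluennecke_ruzsa\<close> is played by \<open>1 / E\<close>.
\<close>
lemma pluennecke_ruzsa_diff:
  assumes E: "finite E" "E \<subseteq> carrier G" "E \<noteq> {}"
    and L: "real (card (set_div G E E)) \<le> L * real (card E)"
  shows "real (card (set_div G (set_pow G E m) (set_pow G E n))) \<le> L ^ (m + n) * real (card E)"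
proof -
  have c: "card (m_inv G ` E) = card E" using E card_inv_image by blast
  have "m_inv G ` E <#> E \<subseteq> set_div G E E"
  proof
    fix w assume "w \<in> m_inv G ` E <#> E"
    then obtain v x where vx: "v \<in> m_inv G ` E" "x \<in> E" "w = v \<otimes> x" by (rule set_multE)
    then obtain y where y: "y \<in> E" "v = inv y" by blast
    have "w = x \<otimes> inv y" unfolding vx y by (rule m_comm) (use vx y E in auto)
    thus "w \<in> set_div G E E" using vx y by (auto intro: set_divI)
  qed
  hence "card (m_inv G ` E <#> E) \<le> card (set_div G E E)" using E by (intro card_mono) auto
  hence "real (card (m_inv G ` E <#> E)) \<le> L * real (card (m_inv G ` E))"
    unfolding c using L by linarith
  hence "real (card (set_div G (set_pow G E m) (set_pow G E n))) \<le> L ^ (m + n) * real (card (m_inv G ` E))"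
    using E by (intro pluennecke_ruzsa) auto
  thus ?thesis using c by simp
qed

lemma set_pow_set_div:
  assumes E: "E \<subseteq> carrier G"
  shows "set_pow G (set_div G E E) n \<subseteq> set_div G (set_pow G E n) (set_pow G E n)"
proof (induction n)
  case 0
  show ?case using set_divI[of \<one> "{\<one>}" \<one> "{\<one>}" G] by simp
next
  case (Suc n)
  show ?case
  proof
    fix w assume "w \<in> set_pow G (set_div G E E) (Suc n)"
    then obtain d e where de: "d \<in> set_div G E E" "e \<in> set_pow G (set_div G E E) n" "w = d \<otimes> e"
      unfolding set_pow.simps by (rule set_multE)
    obtain x y where xy: "x \<in> E" "y \<in> E" "d = x \<otimes> inv y" using de(1) by (rule set_divE)
    have "e \<in> set_div G (set_pow G E n) (set_pow G E n)" using de Suc by blast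
    then obtain x' y' where xy': "x' \<in> set_pow G E n" "y' \<in> set_pow G E n" "e = x' \<otimes> inv y'"
      by (rule set_divE)
    have c: "x \<in> carrier G" "y \<in> carrier G" "x' \<in> carrier G" "y' \<in> carrier G"
      using xy xy' E set_pow_closed[OF E] by auto
    have "w = (x \<otimes> x') \<otimes> (inv y \<otimes> inv y')"
      unfolding de xy xy' by (rule mult_swap) (use c in auto)
    also have "inv y \<otimes> inv y' = inv (y \<otimes> y')" using c by (simp add: inv_mult)
    finally show "w \<in> set_div G (set_pow G E (Suc n)) (set_pow G E (Suc n))"
      using xy xy' by (auto intro!: set_divI set_multI)
  qed
qed

end

section \<open>Small quotient sets and few differences in a field\<close>

context field
begin

lemma mult_of_comm_group: "comm_group (mult_of R)"
  using units_comm_group by (simp add: mult_of_is_Units)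

lemma sumset_I: "x \<in> S \<Longrightarrow> y \<in> T \<Longrightarrow> x \<oplus> y \<in> S <#>\<^bsub>add_monoid R\<^esub> T"
  using set_multI[of x S y T "add_monoid R"] by simp

lemma diffset_I: "x \<in> S \<Longrightarrow> y \<in> T \<Longrightarrow> x \<ominus> y \<in> set_div (add_monoid R) S T"
  using set_divI[of x S y T "add_monoid R"] by (simp add: a_minus_def a_inv_def)

lemma diffset_E:
  assumes "z \<in> set_div (add_monoid R) S T"
  obtains x y where "x \<in> S" "y \<in> T" "z = x \<ominus> y"
  using assms by (auto simp: a_minus_def a_inv_def elim: set_divE)

lemma mult_cancel_left: 
  "a \<in> carrier R - {\<zero>} \<Longrightarrow> x \<in> carrier R \<Longrightarrow> y \<in> carrier R \<Longrightarrow> a \<otimes> x = a \<otimes> y \<Longrightarrow> x = y"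
  using m_lcancel by auto

text \<open>
  If \<open>u w = v w'\<close> with \<open>w, w' \<in> U\<close>, then \<open>u - v = u (1 + w) - v (1 + w')\<close>. A pair with large overlap
  therefore has a difference with at least \<open>m\<close> representations as a difference of elements of \<open>S\<close>.
\<close>
lemma few_popular_differences:
  assumes U: "finite U" "U \<subseteq> carrier R - {\<zero>}" and S: "S = U <#>\<^bsub>R\<^esub> ((\<lambda>u. \<one> \<oplus> u) ` U)"
  shows "m * real (card ((\<lambda>z. fst z \<ominus> snd z) `
            {z \<in> U \<times> U. m \<le> real (card (overlap R U (fst z) (snd z)))})) \<le> (real (card S))\<^sup>2"
    (is "m * real (card ?V) \<le> _")
proof -
  have fS: "finite S" using U S by auto
  have "m * real (card ?V) \<le> real (card (S \<times> S))"
  proof (rule card_image_times_le_card[where f = "\<lambda>z. fst z \<ominus> snd z"])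
    show "finite (S \<times> S)" using fS by simp
    show "finite ?V" using U by simp
    fix r assume "r \<in> ?V"
    then obtain z where z: "z \<in> U \<times> U" "m \<le> real (card (overlap R U (fst z) (snd z)))"
      and rz: "r = fst z \<ominus> snd z" by blast
    define u v where "u = fst z" and "v = snd z"
    have uv: "u \<in> U" "v \<in> U" "m \<le> real (card (overlap R U u v))" "r = u \<ominus> v"
      using z rz by (auto simp: u_def v_def)
    have c: "x \<in> carrier R" if "x \<in> U" for x using that U by auto
    have "\<forall>w\<in>overlap R U u v. \<exists>w'. w' \<in> U \<and> u \<otimes> w = v \<otimes> w'" by (auto simp: overlap_def)
    then obtain h where h: "\<And>w. w \<in> overlap R U u v \<Longrightarrow> h w \<in> U \<and> u \<otimes> w = v \<otimes> h w"
      by (auto dest!: bchoice)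
    have oU: "w \<in> U" if "w \<in> overlap R U u v" for w using that by (simp add: overlap_def)
    let ?g = "\<lambda>w. (u \<otimes> (\<one> \<oplus> w), v \<otimes> (\<one> \<oplus> h w))"
    have "inj_on ?g (overlap R U u v)"
    proof (rule inj_onI)
      fix w w' assume w: "w \<in> overlap R U u v" "w' \<in> overlap R U u v" "?g w = ?g w'"
      have "\<one> \<oplus> w = \<one> \<oplus> w'"
        by (rule mult_cancel_left[of u]) (use w(3) uv U oU[OF w(1)] oU[OF w(2)] in auto)
      thus "w = w'" using c[OF oU[OF w(1)]] c[OF oU[OF w(2)]] by simp
    qed
    moreover have "?g ` overlap R U u v \<subseteq> {z \<in> S \<times> S. fst z \<ominus> snd z = r}"
    proof
      fix t assume "t \<in> ?g ` overlap R U u v"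
      then obtain w where w: "w \<in> overlap R U u v" "t = ?g w" by blast
      have cc: "u \<in> carrier R" "v \<in> carrier R" "w \<in> carrier R" "h w \<in> carrier R"
        using uv c oU[OF w(1)] h[OF w(1)] by auto
      have "u \<otimes> (\<one> \<oplus> w) \<ominus> v \<otimes> (\<one> \<oplus> h w) = (u \<oplus> u \<otimes> w) \<ominus> (v \<oplus> v \<otimes> h w)"
        using cc by (simp add: r_distr)
      also have "\<dots> = (u \<oplus> v \<otimes> h w) \<ominus> (v \<oplus> v \<otimes> h w)" using h[OF w(1)] by simp
      also have "\<dots> = u \<ominus> v" using cc by algebra
      finally show "t \<in> {z \<in> S \<times> S. fst z \<ominus> snd z = r}"
        using w uv oU[OF w(1)] h[OF w(1)] by (auto simp: S intro!: set_multI)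
    qed
    ultimately have "card (overlap R U u v) \<le> card {z \<in> S \<times> S. fst z \<ominus> snd z = r}"
      using fS by (intro card_inj_on_le[of ?g]) auto
    thus "m \<le> real (card {z \<in> S \<times> S. fst z \<ominus> snd z = r})" using uv by linarith
  qed
  thus ?thesis by (simp add: card_cartesian_product power2_eq_square)
qed

lemma popular_quotients_mult_of:
  assumes U: "finite U" "U \<subseteq> carrier R - {\<zero>}"
    and D: "real (card (set_div (mult_of R) U U)) \<le> D" "D > 0"
    and m: "m = (real (card U))\<^sup>2 / (16 * D)"
  shows "\<exists>U'\<subseteq>U. 3 / 4 * real (card U) \<le> real (card U') \<and>
    (\<forall>u\<in>U'. 3 / 4 * real (card U) \<le> real (card {v \<in> U. m \<le> real (card (overlap R U u v))}))"
proof -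
  have "overlap (mult_of R) = overlap R" by (simp add: overlap_def fun_eq_iff)
  thus ?thesis
    using comm_group.popular_quotients[OF mult_of_comm_group U(1) _ D m] U by simp
qed

text \<open>
  Let \<open>M\<close> be the set of differences of popular pairs. For \<open>x, y \<in> U'\<close>, at least half of all \<open>w \<in> U\<close> are
  popular partners of both, and each gives a representation \<open>x - y = (x - w) - (y - w)\<close> as a
  difference of two elements of \<open>M\<close>.
\<close>
lemma subset_with_small_differences:
  assumes U: "finite U" "U \<subseteq> carrier R - {\<zero>}" "U \<noteq> {}"
    and D: "real (card (set_div (mult_of R) U U)) \<le> D" "D > 0"
    and s: "real (card (U <#>\<^bsub>R\<^esub> ((\<lambda>u. \<one> \<oplus> u) ` U))) \<le> s"
  shows "\<exists>U'\<subseteq>U. 3 / 4 * real (card U) \<le> real (card U') \<and>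
     real (card (set_div (add_monoid R) U' U')) \<le> 512 * D\<^sup>2 * s ^ 4 / real (card U) ^ 5"
proof -
  let ?n = "real (card U)"
  define m where "m = ?n\<^sup>2 / (16 * D)"
  have n0: "?n > 0" using U by (simp add: card_gt_0_iff)
  have m0: "m > 0" using n0 D by (simp add: m_def)
  define M where "M = (\<lambda>z. fst z \<ominus> snd z) ` {z \<in> U \<times> U. m \<le> real (card (overlap R U (fst z) (snd z)))}"
  have fM: "finite M" using U by (auto simp: M_def)
  have "m * real (card M) \<le> (real (card (U <#>\<^bsub>R\<^esub> ((\<lambda>u. \<one> \<oplus> u) ` U))))\<^sup>2"
    using few_popular_differences[OF U(1,2) refl] unfolding M_def .
  also have "\<dots> \<le> s\<^sup>2" using s by (intro power_mono) auto
  finally have "real (card M) \<le> s\<^sup>2 / m" using m0 by (simp add: pos_le_divide_eq mult.commute)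
  hence Mle: "real (card M) \<le> 16 * D * s\<^sup>2 / ?n\<^sup>2"
    by (simp add: m_def mult.commute)
  obtain U' where U': "U' \<subseteq> U" "3 / 4 * ?n \<le> real (card U')"
    and pop: "\<And>u. u \<in> U' \<Longrightarrow> 3 / 4 * ?n \<le> real (card {v \<in> U. m \<le> real (card (overlap R U u v))})"
    using popular_quotients_mult_of[OF U(1,2) D m_def] by blast
  have fU': "finite U'" using U' U finite_subset by blast
  let ?V = "set_div (add_monoid R) U' U'"
  have "?n / 2 * real (card ?V) \<le> real (card (M \<times> M))"
  proof (rule card_image_times_le_card[where f = "\<lambda>z. fst z \<ominus> snd z"])
    fix r assume "r \<in> ?V"
    then obtain x y where xy: "x \<in> U'" "y \<in> U'" "r = x \<ominus> y" by (rule diffset_E)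
    let ?g = "\<lambda>u. {v \<in> U. m \<le> real (card (overlap R U u v))}"
    have "card (?g x \<union> ?g y) \<le> card U" using U by (intro card_mono) auto
    moreover have "card (?g x) + card (?g y) = card (?g x \<union> ?g y) + card (?g x \<inter> ?g y)"
      using U by (intro card_Un_Int) auto
    ultimately have "?n / 2 \<le> real (card (?g x \<inter> ?g y))"
      using pop[OF xy(1)] pop[OF xy(2)] by linarith
    also have "card (?g x \<inter> ?g y) \<le> card {z \<in> M \<times> M. fst z \<ominus> snd z = r}"
    proof (rule card_inj_on_le[of "\<lambda>w. (x \<ominus> w, y \<ominus> w)"])
      have xc: "x \<in> carrier R" "y \<in> carrier R" using xy U' U by auto
      show "inj_on (\<lambda>w. (x \<ominus> w, y \<ominus> w)) (?g x \<inter> ?g y)"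
      proof (rule inj_onI)
        fix w w' assume w: "w \<in> ?g x \<inter> ?g y" "w' \<in> ?g x \<inter> ?g y" "(x \<ominus> w, y \<ominus> w) = (x \<ominus> w', y \<ominus> w')"
        have wc: "w \<in> carrier R" "w' \<in> carrier R" using w U by auto
        have "w = x \<ominus> (x \<ominus> w)" using xc wc by algebra
        also have "\<dots> = x \<ominus> (x \<ominus> w')" using w by simp
        also have "\<dots> = w'" using xc wc by algebra
        finally show "w = w'" .
      qed
      show "(\<lambda>w. (x \<ominus> w, y \<ominus> w)) ` (?g x \<inter> ?g y) \<subseteq> {z \<in> M \<times> M. fst z \<ominus> snd z = r}"
      proof
        fix t assume "t \<in> (\<lambda>w. (x \<ominus> w, y \<ominus> w)) ` (?g x \<inter> ?g y)"
        then obtain w where w: "w \<in> ?g x" "w \<in> ?g y" "t = (x \<ominus> w, y \<ominus> w)" by blast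
        have wc: "w \<in> carrier R" using w U by auto
        have "(x \<ominus> w) \<ominus> (y \<ominus> w) = r" unfolding xy using xc wc by algebra
        moreover have "x \<ominus> w \<in> M"
          unfolding M_def by (rule image_eqI[of _ _ "(x, w)"]) (use w xy U' in auto)
        moreover have "y \<ominus> w \<in> M"
          unfolding M_def by (rule image_eqI[of _ _ "(y, w)"]) (use w xy U' in auto)
        ultimately show "t \<in> {z \<in> M \<times> M. fst z \<ominus> snd z = r}" using w by simp
      qed
    qed (use fM in auto)
    finally show "?n / 2 \<le> real (card {z \<in> M \<times> M. fst z \<ominus> snd z = r})" by simp
  qed (use fM fU' in auto)
  also have "\<dots> = real (card M) ^ 2" by (simp add: card_cartesian_product power2_eq_square)
  also have "\<dots> \<le> (16 * D * s\<^sup>2 / ?n\<^sup>2)\<^sup>2" using Mle by (intro power_mono) auto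
  finally have "real (card ?V) \<le> (16 * D * s\<^sup>2 / ?n\<^sup>2)\<^sup>2 * (2 / ?n)"
    using n0 by (simp add: field_simps)
  also have "\<dots> = 512 * D\<^sup>2 * s ^ 4 / ?n ^ 5"
    using n0 by (simp add: field_simps power2_eq_square power4_eq_xxxx eval_nat_numeral)
  finally show ?thesis using U' by blast
qed

text \<open>
  Choose \<open>b\<close> such that \<open>a B\<close> and \<open>b B\<close> have a large common part \<open>T\<close> for most \<open>a\<close>. Since \<open>a B - T\<close> is
  contained in \<open>a (B - B)\<close>, the covering lemma covers \<open>a B\<close> by few translates of
  \<open>T - T \<subseteq> b B - b B\<close>. The same set \<open>b B - b B\<close> serves all \<open>a\<close>, which allows several dilates to be
  added.
\<close>
lemma dilates_covered:
  assumes B: "finite B" "B \<subseteq> carrier R - {\<zero>}" "B \<noteq> {}"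
    and D: "real (card (set_div (mult_of R) B B)) \<le> D" "D > 0"
    and L: "real (card (set_div (add_monoid R) B B)) \<le> L * real (card B)"
  shows "\<exists>b\<in>B. \<exists>B'\<subseteq>B. 3 / 4 * real (card B) \<le> real (card B') \<and>
    (\<forall>a\<in>B'. covered (add_monoid R) (set_div (add_monoid R) ((\<lambda>x. b \<otimes> x) ` B) ((\<lambda>x. b \<otimes> x) ` B))
       (16 * L * D / real (card B)) 1 ((\<lambda>x. a \<otimes> x) ` B))"
proof -
  let ?n = "real (card B)"
  define m where "m = ?n\<^sup>2 / (16 * D)"
  have n0: "?n > 0" using B by (simp add: card_gt_0_iff)
  have m0: "m > 0" using n0 D by (simp add: m_def)
  obtain U where U: "U \<subseteq> B" "3 / 4 * ?n \<le> real (card U)"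
    and pop: "\<And>u. u \<in> U \<Longrightarrow> 3 / 4 * ?n \<le> real (card {v \<in> B. m \<le> real (card (overlap R B u v))})"
    using popular_quotients_mult_of[OF B(1,2) D m_def] by blast
  have "U \<noteq> {}" using U n0 by auto
  then obtain b where b: "b \<in> U" by blast
  hence bB: "b \<in> B" using U by auto
  define B' where "B' = {v \<in> B. m \<le> real (card (overlap R B b v))}"
  have cB: "x \<in> carrier R" "x \<in> carrier R - {\<zero>}" if "x \<in> B" for x using that B by auto
  have "covered (add_monoid R) (set_div (add_monoid R) ((\<lambda>x. b \<otimes> x) ` B) ((\<lambda>x. b \<otimes> x) ` B))
       (16 * L * D / ?n) 1 ((\<lambda>x. a \<otimes> x) ` B)" if "a \<in> B'" for a
  proof -
    have a: "a \<in> B" "m \<le> real (card (overlap R B b a))" using that by (auto simp: B'_def)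
    let ?aB = "(\<lambda>x. a \<otimes> x) ` B" and ?bB = "(\<lambda>x. b \<otimes> x) ` B"
    define T where "T = (\<lambda>x. b \<otimes> x) ` overlap R B b a"
    have inj: "inj_on (\<lambda>x. b \<otimes> x) (overlap R B b a)"
      by (rule inj_onI, rule mult_cancel_left[of b]) (use cB bB in \<open>auto simp: overlap_def\<close>)
    have cT: "m \<le> real (card T)" using a card_image[OF inj] by (simp add: T_def)
    have TaB: "T \<subseteq> ?aB" and TbB: "T \<subseteq> ?bB" by (auto simp: T_def overlap_def)
    have caB: "?aB \<subseteq> carrier R" using a cB by auto
    have cbB: "?bB \<subseteq> carrier R" using bB cB by auto
    have "T \<noteq> {}" using cT m0 by auto
    have "\<exists>X\<subseteq>?aB. card X * card T \<le> card (set_div (add_monoid R) ?aB T) \<and>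
        ?aB \<subseteq> X <#>\<^bsub>add_monoid R\<^esub> set_div (add_monoid R) T T"
    proof (rule add.ruzsa_covering)
      show "T \<subseteq> carrier R" "?aB \<subseteq> carrier R" using TaB caB by auto
      show "finite ?aB" "finite T" using B finite_subset[OF TaB] by simp_all
      show "T \<noteq> {}" by fact
    qed
    then obtain X where X: "X \<subseteq> ?aB" "card X * card T \<le> card (set_div (add_monoid R) ?aB T)"
      and cov: "?aB \<subseteq> X <#>\<^bsub>add_monoid R\<^esub> set_div (add_monoid R) T T"
      by blast
    have "set_div (add_monoid R) ?aB T \<subseteq> (\<lambda>x. a \<otimes> x) ` set_div (add_monoid R) B B"
    proof
      fix w assume "w \<in> set_div (add_monoid R) ?aB T"
      then obtain p t where pt: "p \<in> ?aB" "t \<in> T" "w = p \<ominus> t" by (rule diffset_E)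
      then obtain x y where xy: "x \<in> B" "y \<in> B" "p = a \<otimes> x" "t = a \<otimes> y" using TaB by blast
      have "w = a \<otimes> (x \<ominus> y)"
        using cB(1)[OF a(1)] cB(1)[OF xy(1)] cB(1)[OF xy(2)] unfolding pt xy by algebra
      thus "w \<in> (\<lambda>x. a \<otimes> x) ` set_div (add_monoid R) B B" using xy by (auto intro: diffset_I)
    qed
    hence "card (set_div (add_monoid R) ?aB T) \<le> card (set_div (add_monoid R) B B)"
      using B by (meson finite_set_div surj_card_le)
    hence "real (card X * card T) \<le> L * ?n" using X L by linarith
    moreover have "real (card X) * m \<le> real (card X) * real (card T)"
      using cT by (intro mult_left_mono) auto
    ultimately have "real (card X) * m \<le> L * ?n" by simp
    hence "real (card X) \<le> L * ?n / m" using m0 by (simp add: pos_le_divide_eq)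
    also have "\<dots> = 16 * L * D / ?n" using n0 D by (simp add: m_def field_simps power2_eq_square)
    finally have cX: "real (card X) \<le> (16 * L * D / ?n) ^ 1" by simp
    have "set_div (add_monoid R) T T \<subseteq> set_div (add_monoid R) ?bB ?bB"
      using TbB by (intro set_div_mono)
    moreover have "set_pow (add_monoid R) (set_div (add_monoid R) ?bB ?bB) 1
        = set_div (add_monoid R) ?bB ?bB"
      using add.set_pow_1 add.set_div_closed[of ?bB ?bB] cbB by simp
    ultimately have "?aB \<subseteq> X <#>\<^bsub>add_monoid R\<^esub>
        set_pow (add_monoid R) (set_div (add_monoid R) ?bB ?bB) 1"
      by (intro order_trans[OF cov] mono_set_mult) auto
    moreover have "finite X" using X B finite_subset by blast
    ultimately show ?thesis using X caB cX unfolding covered_def by (intro exI[of _ X]) auto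
  qed
  moreover have "B' \<subseteq> B" by (auto simp: B'_def)
  moreover have "3 / 4 * ?n \<le> real (card B')" using pop[OF b] by (simp add: B'_def)
  ultimately show ?thesis using bB by blast
qed

section \<open>The sum-product bound by the pivot method\<close>

lemma card_dilate_image:
  assumes "a \<in> carrier R - {\<zero>}" "S \<subseteq> carrier R"
  shows "card ((\<lambda>x. a \<otimes> x) ` S) = card S"
  by (intro card_image inj_onI, rule mult_cancel_left[OF assms(1)]) (use assms in auto)

lemma diff_nonzero:
  assumes "x \<in> carrier R" "y \<in> carrier R" "x \<noteq> y"
  shows "x \<ominus> y \<in> carrier R - {\<zero>}"
  using assms by (simp add: r_right_minus_eq)

text \<open>
  A collision \<open>x + \<xi> y = x' + \<xi> y'\<close> with \<open>y \<noteq> y'\<close> determines \<open>\<xi>\<close>, so all \<open>\<xi>\<close> together have at most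
  \<open>|B|\<^sup>4\<close> nontrivial collisions. Some \<open>\<xi>\<close> has no more than the average, which is at most \<open>|B|\<^sup>2\<close>.
\<close>
lemma exists_dilate_with_large_sumset:
  assumes fin: "finite (carrier R)" and B: "B \<subseteq> carrier R" "(card B)\<^sup>2 \<le> card (carrier R)" "B \<noteq> {}"
  shows "\<exists>\<xi>\<in>carrier R. (card B)\<^sup>2 \<le> 3 * card ((\<lambda>z. fst z \<oplus> \<xi> \<otimes> snd z) ` (B \<times> B))"
proof -
  have fB: "finite B" using B fin finite_subset by blast
  let ?g = "\<lambda>\<xi> z. fst z \<oplus> \<xi> \<otimes> snd z"
  let ?E = "\<lambda>\<xi>. {w \<in> (B \<times> B) \<times> (B \<times> B). ?g \<xi> (fst w) = ?g \<xi> (snd w)}"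
  let ?X = "{w \<in> (B \<times> B) \<times> (B \<times> B). snd (fst w) \<noteq> snd (snd w)}"
  let ?f = "\<lambda>w. (fst (snd w) \<ominus> fst (fst w)) \<otimes> inv (snd (fst w) \<ominus> snd (snd w))"
  let ?n = "card B"
  have n0: "?n > 0" using fB B by (simp add: card_gt_0_iff)
  have "\<exists>\<xi>\<in>carrier R. card (?E \<xi>) \<le> 3 * ?n\<^sup>2"
  proof (rule ccontr)
    assume "\<not> ?thesis"
    hence big: "3 * ?n\<^sup>2 < card (?E \<xi>)" if "\<xi> \<in> carrier R" for \<xi> using that by auto
    have "real (2 * ?n\<^sup>2) * real (card (carrier R)) \<le> real (card ?X)"
    proof (rule card_image_times_le_card[where f = ?f])
      fix \<xi> assume x: "\<xi> \<in> carrier R"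
      have "?E \<xi> \<subseteq> (\<lambda>z. (z, z)) ` (B \<times> B) \<union> {w \<in> ?X. ?f w = \<xi>}"
      proof
        fix w assume w: "w \<in> ?E \<xi>"
        define x y x' y' where "x = fst (fst w)" and "y = snd (fst w)"
          and "x' = fst (snd w)" and "y' = snd (snd w)"
        have ww: "w = ((x, y), (x', y'))" by (simp add: x_def y_def x'_def y'_def)
        have m: "x \<in> B" "y \<in> B" "x' \<in> B" "y' \<in> B" and eq: "x \<oplus> \<xi> \<otimes> y = x' \<oplus> \<xi> \<otimes> y'"
          using w by (auto simp: ww)
        have c: "x \<in> carrier R" "y \<in> carrier R" "x' \<in> carrier R" "y' \<in> carrier R"
          using m B by auto
        show "w \<in> (\<lambda>z. (z, z)) ` (B \<times> B) \<union> {w \<in> ?X. ?f w = \<xi>}"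
        proof (cases "y = y'")
          case True
          hence "x = x'" using eq c x by simp
          thus ?thesis using True m ww by auto
        next
          case False
          have d: "y \<ominus> y' \<in> carrier R - {\<zero>}" using diff_nonzero c False by blast
          hence du: "y \<ominus> y' \<in> Units R" using field_Units by simp
          have "\<xi> \<otimes> (y \<ominus> y') = (x \<oplus> \<xi> \<otimes> y) \<ominus> x \<ominus> \<xi> \<otimes> y'" using c x by algebra
          also have "\<dots> = (x' \<oplus> \<xi> \<otimes> y') \<ominus> x \<ominus> \<xi> \<otimes> y'" using eq by simp
          also have "\<dots> = x' \<ominus> x" using c x by algebra
          finally have e: "\<xi> \<otimes> (y \<ominus> y') = x' \<ominus> x" .
          have "(x' \<ominus> x) \<otimes> inv (y \<ominus> y') = \<xi> \<otimes> ((y \<ominus> y') \<otimes> inv (y \<ominus> y'))"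
            unfolding e[symmetric] by (rule m_assoc) (use x d du in auto)
          also have "\<dots> = \<xi>" using du x by simp
          finally show ?thesis using False m ww by auto
        qed
      qed
      hence "card (?E \<xi>) \<le> card ((\<lambda>z. (z, z)) ` (B \<times> B) \<union> {w \<in> ?X. ?f w = \<xi>})"
        using fB by (intro card_mono) auto
      also have "\<dots> \<le> card ((\<lambda>z. (z, z)) ` (B \<times> B)) + card {w \<in> ?X. ?f w = \<xi>}" by (rule card_Un_le)
      also have "card ((\<lambda>z. (z, z)) ` (B \<times> B)) = ?n\<^sup>2"
        by (subst card_image) (auto simp: inj_on_def card_cartesian_product power2_eq_square)
      finally show "real (2 * ?n\<^sup>2) \<le> real (card {w \<in> ?X. ?f w = \<xi>})"
        using big[OF x] by (intro of_nat_mono) linarith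
    qed (use fB fin in auto)
    also have "card ?X \<le> card ((B \<times> B) \<times> (B \<times> B))" using fB by (intro card_mono) auto
    also have "\<dots> = ?n\<^sup>2 * ?n\<^sup>2" by (simp add: card_cartesian_product power2_eq_square)
    finally have "2 * ?n\<^sup>2 * card (carrier R) \<le> ?n\<^sup>2 * ?n\<^sup>2"
      by (simp only: of_nat_mult[symmetric] of_nat_le_iff)
    hence "?n\<^sup>2 * (2 * card (carrier R)) \<le> ?n\<^sup>2 * ?n\<^sup>2" by (simp only: mult_ac)
    hence "2 * card (carrier R) \<le> ?n\<^sup>2" using n0 by (subst (asm) mult_le_cancel1) simp
    moreover have "0 < ?n\<^sup>2" using n0 by simp
    ultimately show False using B(2) by linarith
  qed
  then obtain \<xi> where xi: "\<xi> \<in> carrier R" "card (?E \<xi>) \<le> 3 * ?n\<^sup>2" by blast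
  have "?n\<^sup>2 * ?n\<^sup>2 = (card (B \<times> B))\<^sup>2" by (simp add: card_cartesian_product power2_eq_square)
  also have "\<dots> \<le> card (?g \<xi> ` (B \<times> B)) * card (?E \<xi>)"
    using card_square_le_collisions[of "B \<times> B" "?g \<xi>"] fB by simp
  also have "\<dots> \<le> card (?g \<xi> ` (B \<times> B)) * (3 * ?n\<^sup>2)" using xi by (intro mult_left_mono) auto
  finally have "?n\<^sup>2 * ?n\<^sup>2 \<le> ?n\<^sup>2 * (3 * card (?g \<xi> ` (B \<times> B)))" by (simp only: mult_ac)
  hence "?n\<^sup>2 \<le> 3 * card (?g \<xi> ` (B \<times> B))" using n0 by (subst (asm) mult_le_cancel1) simp
  thus ?thesis using xi by blast
qed

text \<open>
  The hypothesis \<open>gen\<close> says that 1 generates the additive group. If the quotients of differences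
  \<open>Q = (B - B) / (B - B)\<close> do not exhaust the field, then \<open>r \<in> Q\<close> and \<open>r + 1 \<notin> Q\<close> for some \<open>r\<close>, and
  \<open>(x, y) \<mapsto> x + (r + 1) y\<close> is injective on \<open>B \<times> B\<close>, as a collision would express \<open>r + 1\<close> as an
  element of \<open>Q\<close>. If they do, any \<open>\<xi>\<close> with a large sumset is admissible.
\<close>
lemma exists_pivot:
  assumes fin: "finite (carrier R)"
    and gen: "\<And>S. S \<subseteq> carrier R \<Longrightarrow> \<zero> \<in> S \<Longrightarrow> (\<And>x. x \<in> S \<Longrightarrow> x \<oplus> \<one> \<in> S) \<Longrightarrow> S = carrier R"
    and B: "B \<subseteq> carrier R" "(card B)\<^sup>2 \<le> card (carrier R)" "2 \<le> card B"
  shows "\<exists>\<xi>\<in>carrier R. \<exists>a\<in>B. \<exists>b\<in>B. \<exists>c\<in>B. \<exists>d\<in>B. c \<noteq> d \<and> (\<xi> \<ominus> \<one>) \<otimes> (c \<ominus> d) = a \<ominus> b \<and>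
    (card B)\<^sup>2 \<le> 3 * card ((\<lambda>z. fst z \<oplus> \<xi> \<otimes> snd z) ` (B \<times> B))"
proof -
  define Q where "Q = {r \<in> carrier R. \<exists>a\<in>B. \<exists>b\<in>B. \<exists>c\<in>B. \<exists>d\<in>B. c \<noteq> d \<and> r \<otimes> (c \<ominus> d) = a \<ominus> b}"
  have fB: "finite B" using B fin finite_subset by blast
  have "\<exists>\<xi>\<in>carrier R. \<xi> \<ominus> \<one> \<in> Q \<and> (card B)\<^sup>2 \<le> 3 * card ((\<lambda>z. fst z \<oplus> \<xi> \<otimes> snd z) ` (B \<times> B))"
  proof (cases "Q = carrier R")
    case True
    have "B \<noteq> {}" using B by auto
    thus ?thesis using exists_dilate_with_large_sumset[OF fin B(1,2)] True by auto
  next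
    case False
    have "\<zero> \<in> Q"
    proof -
      obtain a b where ab: "a \<in> B" "b \<in> B" "a \<noteq> b"
        using B(3) fB by (metis card_le_Suc0_iff_eq not_less_eq_eq numeral_2_eq_2)
      have "a \<in> carrier R" "b \<in> carrier R" using ab B by auto
      hence "\<zero> \<otimes> (a \<ominus> b) = a \<ominus> a" by algebra
      thus ?thesis using ab unfolding Q_def by blast
    qed
    moreover have "Q \<subseteq> carrier R" unfolding Q_def by blast
    ultimately obtain r where r: "r \<in> Q" "r \<oplus> \<one> \<notin> Q" using gen[of Q] False by blast
    define \<xi> where "\<xi> = r \<oplus> \<one>"
    have rc: "r \<in> carrier R" using r by (simp add: Q_def)
    hence xc: "\<xi> \<in> carrier R" by (simp add: \<xi>_def)
    have "\<xi> \<ominus> \<one> = r" unfolding \<xi>_def using rc by algebra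
    moreover have "inj_on (\<lambda>z. fst z \<oplus> \<xi> \<otimes> snd z) (B \<times> B)"
    proof (rule inj_onI, clarsimp)
      fix x y x' y' assume m: "x \<in> B" "y \<in> B" "x' \<in> B" "y' \<in> B" and eq: "x \<oplus> \<xi> \<otimes> y = x' \<oplus> \<xi> \<otimes> y'"
      have c: "x \<in> carrier R" "y \<in> carrier R" "x' \<in> carrier R" "y' \<in> carrier R" using m B by auto
      have "\<xi> \<otimes> (y \<ominus> y') = (x \<oplus> \<xi> \<otimes> y) \<ominus> x \<ominus> \<xi> \<otimes> y'" using c xc by algebra
      also have "\<dots> = (x' \<oplus> \<xi> \<otimes> y') \<ominus> x \<ominus> \<xi> \<otimes> y'" using eq by simp
      also have "\<dots> = x' \<ominus> x" using c xc by algebra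
      finally have "\<xi> \<otimes> (y \<ominus> y') = x' \<ominus> x" .
      hence "y = y'" using r(2) m xc unfolding \<xi>_def[symmetric] Q_def by blast
      thus "x = x' \<and> y = y'" using eq c xc by simp
    qed
    hence "card ((\<lambda>z. fst z \<oplus> \<xi> \<otimes> snd z) ` (B \<times> B)) = (card B)\<^sup>2"
      by (simp add: card_image card_cartesian_product power2_eq_square)
    ultimately show ?thesis using r(1) xc by auto
  qed
  thus ?thesis unfolding Q_def by blast
qed

text \<open>
  The pivot \<open>\<xi>\<close> is taken from the subset \<open>B'\<close> of those \<open>a\<close> for which \<open>a B\<close> is covered by few translates
  of a common difference set. Multiplying \<open>x + \<xi> y\<close> by \<open>c - d\<close> clears the denominator of \<open>\<xi>\<close> and produces
  a sum of six covered dilates, so that \<open>|B'|\<^sup>2\<close> is at most of the order \<open>q\<^sup>6 L\<^sup>1\<^sup>2 |B|\<close>, where \<open>q\<close> is the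
  number of translates.
\<close>
lemma sum_product_bound:
  assumes fin: "finite (carrier R)"
    and gen: "\<And>S. S \<subseteq> carrier R \<Longrightarrow> \<zero> \<in> S \<Longrightarrow> (\<And>x. x \<in> S \<Longrightarrow> x \<oplus> \<one> \<in> S) \<Longrightarrow> S = carrier R"
    and B: "B \<subseteq> carrier R - {\<zero>}" "(card B)\<^sup>2 \<le> card (carrier R)" "B \<noteq> {}"
    and D: "real (card (set_div (mult_of R) B B)) \<le> D"
    and L: "real (card (set_div (add_monoid R) B B)) \<le> L * real (card B)"
  shows "real (card B) \<le> 6 * (16 * L * D / real (card B)) ^ 6 * L ^ 12"
proof -
  let ?n = "real (card B)"
  let ?A = "add_monoid R"
  define q where "q = 16 * L * D / ?n"
  have fB: "finite B" using B fin finite_subset by blast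
  have cB: "x \<in> carrier R" if "x \<in> B" for x using B that by auto
  have n0: "?n > 0" using fB B by (simp add: card_gt_0_iff)
  obtain x0 where x0: "x0 \<in> B" using B by auto
  have "(\<lambda>x. x \<ominus> x0) ` B \<subseteq> set_div ?A B B" using x0 by (auto intro: diffset_I)
  moreover have "inj_on (\<lambda>x. x \<ominus> x0) B"
  proof (rule inj_onI)
    fix x y assume xy: "x \<in> B" "y \<in> B" "x \<ominus> x0 = y \<ominus> x0"
    have "x = (x \<ominus> x0) \<oplus> x0" using cB[OF xy(1)] cB[OF x0] by algebra
    also have "\<dots> = (y \<ominus> x0) \<oplus> x0" using xy by simp
    also have "\<dots> = y" using cB[OF xy(2)] cB[OF x0] by algebra
    finally show "x = y" .
  qed
  ultimately have "card B \<le> card (set_div ?A B B)" using fB by (metis card_image card_mono finite_set_div)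
  hence "?n \<le> L * ?n" using L by linarith
  hence L1: "L \<ge> 1" using n0 by simp
  have "card B \<le> card (set_div (mult_of R) B B)"
  proof -
    interpret M: comm_group "mult_of R" by (rule mult_of_comm_group)
    have "card B \<le> card (B <#>\<^bsub>mult_of R\<^esub> (m_inv (mult_of R) ` B))"
      by (rule M.card_le_card_set_mult) (use B fB M.inv_closed in auto)
    thus ?thesis by (simp add: set_div_def)
  qed
  hence Dn: "D \<ge> ?n" using D by linarith
  have D0: "D > 0" using Dn n0 by linarith
  have q0: "q \<ge> 0" using L1 D0 n0 by (simp add: q_def)
  obtain b0 B' where b0: "b0 \<in> B" and B': "B' \<subseteq> B" "3 / 4 * ?n \<le> real (card B')"
    and cov: "\<And>a. a \<in> B' \<Longrightarrow> covered ?A (set_div ?A ((\<lambda>x. b0 \<otimes> x) ` B) ((\<lambda>x. b0 \<otimes> x) ` B)) q 1 ((\<lambda>x. a \<otimes> x) ` B)"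
    using dilates_covered[OF fB B(1,3) D D0 L] unfolding q_def by blast
  define E where "E = (\<lambda>x. b0 \<otimes> x) ` B"
  define F where "F = set_div ?A E E"
  have cE: "E \<subseteq> carrier R" using b0 cB by (auto simp: E_def)
  have fE: "finite E" "E \<noteq> {}" using fB B by (auto simp: E_def)
  have cardE: "card E = card B"
    unfolding E_def by (rule card_dilate_image) (use b0 B in auto)
  have cF: "F \<subseteq> carrier R" using cE by (auto simp: F_def elim!: diffset_E)
  have Finv: "\<ominus> d \<in> F" if dF: "d \<in> F" for d
  proof -
    obtain x y where xy: "x \<in> E" "y \<in> E" "d = x \<ominus> y" using dF unfolding F_def by (rule diffset_E)
    have "\<ominus> d = y \<ominus> x" unfolding xy using xy cE by (simp add: subset_iff) algebra
    thus ?thesis using xy by (auto simp: F_def intro: diffset_I)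
  qed
  \<comment> \<open>A pivot needs two distinct elements, so a singleton is treated apart.\<close>
  show ?thesis
  proof (cases "card B = 1")
    case True
    have "1 \<le> q" unfolding q_def using L1 Dn True mult_mono[of 1 L 1 D] by auto
    have "1 \<le> q ^ 6" "1 \<le> L ^ 12" using \<open>1 \<le> q\<close> L1 by auto
    hence "1 \<le> q ^ 6 * L ^ 12" using mult_mono[of 1 "q ^ 6" 1 "L ^ 12"] by simp
    thus ?thesis using True unfolding q_def by simp
  next
    case False
    hence "card B \<ge> 2" using n0 by linarith
    hence B'2: "2 \<le> card B'" using B' by linarith
    have cardB': "card B' \<le> card B" using B' fB by (intro card_mono)
    hence "(card B')\<^sup>2 \<le> card (carrier R)" using B(2) by (meson order_trans power_mono zero_le)
    then obtain \<xi> a b c d where xi: "\<xi> \<in> carrier R" and abcd: "a \<in> B'" "b \<in> B'" "c \<in> B'" "d \<in> B'" "c \<noteq> d"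
      and piv: "(\<xi> \<ominus> \<one>) \<otimes> (c \<ominus> d) = a \<ominus> b"
      and large: "(card B')\<^sup>2 \<le> 3 * card ((\<lambda>z. fst z \<oplus> \<xi> \<otimes> snd z) ` (B' \<times> B'))"
      using exists_pivot[OF fin gen, of B'] B'2 B' cB by blast
    have ca: "a \<in> carrier R" "b \<in> carrier R" "c \<in> carrier R" "d \<in> carrier R"
      using abcd B' cB by auto
    let ?d = "\<lambda>t. (\<lambda>x. t \<otimes> x) ` B" and ?m = "\<lambda>t. (\<lambda>x. \<ominus> x) ` ((\<lambda>x. t \<otimes> x) ` B)"
    define W where "W = ?d c <#>\<^bsub>?A\<^esub> (?d c <#>\<^bsub>?A\<^esub> (?d a <#>\<^bsub>?A\<^esub> (?m d <#>\<^bsub>?A\<^esub> (?m d <#>\<^bsub>?A\<^esub> ?m b))))"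
    have fW: "finite W" using fB by (auto simp: W_def)
    have covd: "covered ?A F q 1 (?d t)" if "t \<in> B'" for t
      using cov[OF that] by (simp add: F_def E_def)
    have covm: "covered ?A F q 1 (?m t)" if "t \<in> B'" for t
      using add.covered_inv[of F q 1 "?d t"] covd[OF that] cF Finv by simp
    have step: "covered ?A F q (m + n) (S <#>\<^bsub>?A\<^esub> T)" if "covered ?A F q m S" "covered ?A F q n T" for m n S T
      using add.covered_mult[of F q m S n T] that q0 cF by simp
    have "covered ?A F q (1 + (1 + (1 + (1 + (1 + 1))))) W"
      unfolding W_def by (intro step covd covm abcd)
    hence "covered ?A F q 6 W" by (simp add: eval_nat_numeral)
    hence "real (card W) \<le> q ^ 6 * real (card (set_pow ?A F 6))"
      using fE by (intro add.card_covered_le[of F q 6 W]) (auto simp: F_def)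
    also have "real (card (set_pow ?A F 6)) \<le> real (card (set_div ?A (set_pow ?A E 6) (set_pow ?A E 6)))"
      using add.set_pow_set_div[of E 6] cE fE unfolding F_def by (intro of_nat_mono card_mono) auto
    also have "\<dots> \<le> L ^ (6 + 6) * real (card E)"
    proof (rule add.pluennecke_ruzsa_diff)
      have "set_div ?A E E \<subseteq> (\<lambda>x. b0 \<otimes> x) ` set_div ?A B B"
      proof
        fix w assume "w \<in> set_div ?A E E"
        then obtain p r where "p \<in> E" "r \<in> E" "w = p \<ominus> r" by (rule diffset_E)
        then obtain x y where xy: "x \<in> B" "y \<in> B" "w = b0 \<otimes> x \<ominus> b0 \<otimes> y" by (auto simp: E_def)
        have "w = b0 \<otimes> (x \<ominus> y)"
          using cB[OF b0] cB[OF xy(1)] cB[OF xy(2)] unfolding xy by algebra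
        thus "w \<in> (\<lambda>x. b0 \<otimes> x) ` set_div ?A B B" using xy by (auto intro: diffset_I)
      qed
      hence "card (set_div ?A E E) \<le> card (set_div ?A B B)"
        using fB by (meson finite_set_div surj_card_le)
      thus "real (card (set_div ?A E E)) \<le> L * real (card E)" unfolding cardE using L by linarith
    qed (use fE cE in auto)
    finally have Wle: "real (card W) \<le> q ^ 6 * (L ^ 12 * ?n)"
      using q0 by (simp add: cardE mult_left_mono)
    let ?Y = "(\<lambda>z. fst z \<oplus> \<xi> \<otimes> snd z) ` (B' \<times> B')"
    have "(\<lambda>t. (c \<ominus> d) \<otimes> t) ` ?Y \<subseteq> W"
    proof
      fix t assume "t \<in> (\<lambda>t. (c \<ominus> d) \<otimes> t) ` ?Y"
      then obtain x y where xy: "x \<in> B'" "y \<in> B'" "t = (c \<ominus> d) \<otimes> (x \<oplus> \<xi> \<otimes> y)" by auto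
      have xyB: "x \<in> B" "y \<in> B" using xy B' by auto
      have xyc: "x \<in> carrier R" "y \<in> carrier R" using xyB cB by auto
      have "t = (c \<ominus> d) \<otimes> x \<oplus> (c \<ominus> d) \<otimes> y \<oplus> ((\<xi> \<ominus> \<one>) \<otimes> (c \<ominus> d)) \<otimes> y"
        unfolding xy using xyc ca xi by algebra
      also have "\<dots> = (c \<ominus> d) \<otimes> x \<oplus> (c \<ominus> d) \<otimes> y \<oplus> (a \<ominus> b) \<otimes> y" unfolding piv ..
      also have "\<dots> = c \<otimes> x \<oplus> (c \<otimes> y \<oplus> (a \<otimes> y \<oplus> (\<ominus> (d \<otimes> x) \<oplus> (\<ominus> (d \<otimes> y) \<oplus> \<ominus> (b \<otimes> y)))))"
        using xyc ca by algebra
      also have "\<dots> \<in> W" unfolding W_def by (intro sumset_I imageI xyB)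
      finally show "t \<in> W" .
    qed
    hence "card ((\<lambda>t. (c \<ominus> d) \<otimes> t) ` ?Y) \<le> card W" using fW by (intro card_mono)
    moreover have "card ((\<lambda>t. (c \<ominus> d) \<otimes> t) ` ?Y) = card ?Y"
    proof (rule card_dilate_image[OF diff_nonzero[OF ca(3,4) abcd(5)]])
      have "fst z \<oplus> \<xi> \<otimes> snd z \<in> carrier R" if "z \<in> B' \<times> B'" for z
      proof -
        have "fst z \<in> carrier R" "snd z \<in> carrier R" using that B' cB by auto
        thus ?thesis using xi by simp
      qed
      thus "?Y \<subseteq> carrier R" by blast
    qed
    ultimately have "(card B')\<^sup>2 \<le> 3 * card W" using large by linarith
    hence "(real (card B'))\<^sup>2 \<le> 3 * real (card W)"
      by (metis of_nat_le_iff of_nat_mult of_nat_numeral of_nat_power)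
    moreover have "(3 / 4 * ?n)\<^sup>2 \<le> (real (card B'))\<^sup>2" using B' by (intro power_mono) auto
    ultimately have "(3 / 4 * ?n)\<^sup>2 \<le> 3 * (q ^ 6 * (L ^ 12 * ?n))" using Wle by linarith
    hence "?n * ?n \<le> ?n * (16 / 3 * (q ^ 6 * L ^ 12))" by (simp add: power2_eq_square field_simps)
    hence "?n \<le> 16 / 3 * (q ^ 6 * L ^ 12)" using n0 by (subst (asm) mult_le_cancel_left_pos) auto
    moreover have "0 \<le> q ^ 6 * L ^ 12" using q0 L1 by simp
    ultimately show ?thesis unfolding q_def[symmetric] by linarith
  qed
qed

section \<open>From values of \<open>x y (x + y)\<close> to sums and products\<close>

text \<open>
  A pair \<open>(c, u c)\<close> has the value \<open>c\<^sup>3 u (1 + u)\<close>, so \<open>c\<close> is determined up to a cube root of unity.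
\<close>
lemma card_common_ratio_le:
  assumes fin: "finite (carrier R)" and A: "A \<subseteq> carrier R - {\<zero>}" and v: "v \<noteq> \<zero>"
  shows "card {z \<in> A \<times> A. xy_sum R (fst z) (snd z) = v \<and> snd z \<otimes> inv (fst z) = u} \<le> 3"
    (is "card ?Z \<le> 3")
proof (cases "?Z = {}")
  case False
  then obtain z0 where z0: "z0 \<in> ?Z" by blast
  have form: "fst z \<in> carrier R - {\<zero>}" "u \<in> carrier R - {\<zero>}" "\<one> \<oplus> u \<in> carrier R"
      "snd z = u \<otimes> fst z" "fst z [^] (3::nat) \<otimes> (u \<otimes> (\<one> \<oplus> u)) = v"
    if z: "z \<in> ?Z" for z
  proof -
    define c d where "c = fst z" and "d = snd z"
    have c: "c \<in> carrier R - {\<zero>}" and d: "d \<in> carrier R - {\<zero>}" and ud: "d \<otimes> inv c = u"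
      and cv: "xy_sum R c d = v"
      using z A by (auto simp: c_def d_def)
    have ci: "inv c \<in> carrier R - {\<zero>}" "c \<otimes> inv c = \<one>" "inv c \<otimes> c = \<one>" using c field_Units by auto
    have uc: "u \<in> carrier R - {\<zero>}" using ci d by (auto simp: ud[symmetric] integral_iff)
    have "u \<otimes> c = d" unfolding ud[symmetric] using c d ci by (simp add: m_assoc)
    moreover have "c [^] (3::nat) \<otimes> (u \<otimes> (\<one> \<oplus> u)) = (c \<otimes> (u \<otimes> c)) \<otimes> (c \<oplus> u \<otimes> c)"
    proof -
      have "c [^] (3::nat) = c \<otimes> c \<otimes> c" using c by (simp add: eval_nat_numeral)
      thus ?thesis using c uc by simp algebra
    qed
    ultimately show "fst z \<in> carrier R - {\<zero>}" "u \<in> carrier R - {\<zero>}" "\<one> \<oplus> u \<in> carrier R"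
      "snd z = u \<otimes> fst z" "fst z [^] (3::nat) \<otimes> (u \<otimes> (\<one> \<oplus> u)) = v"
      using c uc cv unfolding c_def d_def by (auto simp: xy_sum_def)
  qed
  note f0 = form[OF z0]
  define t where "t = u \<otimes> (\<one> \<oplus> u)"
  have t: "t \<in> carrier R - {\<zero>}" using f0 v by (auto simp: t_def)
  let ?c = "fst z0"
  have ci: "inv ?c \<in> carrier R - {\<zero>}" "?c \<otimes> inv ?c = \<one>" using f0(1) field_Units by auto
  have "card ?Z \<le> card {x \<in> carrier R. x [^] (3::nat) = \<one>}"
  proof (rule card_inj_on_le[of "\<lambda>z. inv ?c \<otimes> fst z"])
    show "inj_on (\<lambda>z. inv ?c \<otimes> fst z) ?Z"
    proof (rule inj_onI)
      fix z z' assume z: "z \<in> ?Z" "z' \<in> ?Z" "inv ?c \<otimes> fst z = inv ?c \<otimes> fst z'"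
      have "fst z = fst z'"
        by (rule mult_cancel_left[OF ci(1) _ _ z(3)]) (use form[OF z(1)] form[OF z(2)] in auto)
      thus "z = z'" using form(4)[OF z(1)] form(4)[OF z(2)] by (simp add: prod_eq_iff)
    qed
    show "(\<lambda>z. inv ?c \<otimes> fst z) ` ?Z \<subseteq> {x \<in> carrier R. x [^] (3::nat) = \<one>}"
    proof
      fix x assume "x \<in> (\<lambda>z. inv ?c \<otimes> fst z) ` ?Z"
      then obtain z where z: "z \<in> ?Z" "x = inv ?c \<otimes> fst z" by blast
      have zc: "fst z \<in> carrier R" using form[OF z(1)] by auto
      have "t \<otimes> fst z [^] (3::nat) = t \<otimes> ?c [^] (3::nat)"
        using form(5)[OF z(1)] f0(5) t zc f0(1) by (simp add: t_def[symmetric] m_comm)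
      hence "fst z [^] (3::nat) = ?c [^] (3::nat)"
        using mult_cancel_left[OF t] zc f0(1) by auto
      hence "x [^] (3::nat) = inv ?c [^] (3::nat) \<otimes> ?c [^] (3::nat)"
        unfolding z(2) using ci zc by (subst nat_pow_distrib) auto
      also have "\<dots> = (inv ?c \<otimes> ?c) [^] (3::nat)" using ci f0(1) by (subst nat_pow_distrib) auto
      also have "\<dots> = \<one>" using ci f0(1) m_comm[of "inv ?c" ?c] by simp
      finally show "x \<in> {x \<in> carrier R. x [^] (3::nat) = \<one>}" using z(2) ci zc by simp
    qed
  qed (use fin in auto)
  also have "\<dots> \<le> 3" by (rule num_roots_le_deg[OF fin]) simp
  finally show ?thesis .
next
  case True
  show ?thesis unfolding True by simp
qed

text \<open>
  The value \<open>v\<close> is found by averaging over the pairs with nonzero sum. The pairs with \<open>d = - c\<close> are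
  excluded because all of them have the value zero, for which \<open>1 + d / c = 0\<close> carries no
  multiplicative information.
\<close>
lemma exists_rich_value:
  assumes fin: "finite (carrier R)" and A: "A \<subseteq> carrier R - {\<zero>}" "2 \<le> card A"
    and K: "real (card (image2 (xy_sum R) A)) \<le> K * real (card A)" "K > 0"
  shows "\<exists>v. v \<noteq> \<zero> \<and> v \<in> carrier R \<and>
    real (card A) / (6 * K) \<le> real (card ((\<lambda>z. snd z \<otimes> inv (fst z)) `
       {z \<in> A \<times> A. xy_sum R (fst z) (snd z) = v}))"
proof -
  let ?n = "real (card A)"
  have fA: "finite A" using A fin finite_subset by blast
  have n2: "?n \<ge> 2" using A by simp
  let ?f = "\<lambda>z. xy_sum R (fst z) (snd z)"
  define X where "X = {z \<in> A \<times> A. fst z \<oplus> snd z \<noteq> \<zero>}"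
  have fX: "finite X" using fA by (simp add: X_def)
  have "card (A \<times> A - X) \<le> card A"
  proof (rule card_inj_on_le[of fst])
    show "inj_on fst (A \<times> A - X)"
    proof (rule inj_onI)
      fix z z' assume z: "z \<in> A \<times> A - X" "z' \<in> A \<times> A - X" "fst z = fst z'"
      have c: "fst z \<in> carrier R" "snd z \<in> carrier R" "snd z' \<in> carrier R" using z A by auto
      have "fst z \<oplus> snd z = fst z \<oplus> snd z'" using z by (auto simp: X_def)
      hence "snd z = snd z'" using c by simp
      thus "z = z'" using z(3) by (simp add: prod_eq_iff)
    qed
  qed (use fA in auto)
  moreover have "card (A \<times> A - X) = card (A \<times> A) - card X"
    using fX by (intro card_Diff_subset) (auto simp: X_def)
  ultimately have "card A * card A \<le> card X + card A" by (simp add: card_cartesian_product)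
  hence "?n * ?n \<le> real (card X) + ?n" by (simp flip: of_nat_mult of_nat_add)
  moreover have "2 * ?n \<le> ?n * ?n" using n2 by (intro mult_right_mono) auto
  ultimately have Xbig: "?n * ?n / 2 \<le> real (card X)" by simp
  moreover have "0 < ?n * ?n" using n2 by simp
  ultimately have "card X \<noteq> 0" by auto
  hence "X \<noteq> {}" by auto
  then obtain v where v: "v \<in> ?f ` X" "card X \<le> card (?f ` X) * card {z \<in> X. ?f z = v}"
    using exists_large_fibre[OF fX, of ?f] by blast
  obtain z0 where z0: "z0 \<in> X" "v = ?f z0" using v by blast
  have "fst z0 \<in> carrier R - {\<zero>}" "snd z0 \<in> carrier R - {\<zero>}" "fst z0 \<oplus> snd z0 \<noteq> \<zero>"
    using z0(1) A by (auto simp: X_def)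
  hence v0: "v \<noteq> \<zero>" "v \<in> carrier R" unfolding z0(2) xy_sum_def by (simp_all add: integral_iff)
  define P where "P = {z \<in> A \<times> A. ?f z = v}"
  have fP: "finite P" using fA by (simp add: P_def)
  have "card (?f ` X) \<le> card (image2 (xy_sum R) A)"
  proof (rule card_mono)
    have "image2 (xy_sum R) A \<subseteq> ?f ` (A \<times> A)" unfolding image2_def by force
    thus "finite (image2 (xy_sum R) A)" using fA finite_surj[of "A \<times> A"] by blast
    show "?f ` X \<subseteq> image2 (xy_sum R) A"
    proof
      fix w assume "w \<in> ?f ` X"
      then obtain z where z: "z \<in> X" "w = ?f z" by blast
      have "fst z \<in> A" "snd z \<in> A" using z(1) by (auto simp: X_def)
      thus "w \<in> image2 (xy_sum R) A" unfolding image2_def z(2) by blast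
    qed
  qed
  hence F: "real (card (?f ` X)) \<le> K * ?n" using K by linarith
  have "real (card X) \<le> real (card (?f ` X)) * real (card {z \<in> X. ?f z = v})"
    using v(2) by (simp flip: of_nat_mult)
  also have "\<dots> \<le> (K * ?n) * real (card P)"
    using F K fP by (intro mult_mono of_nat_mono card_mono) (auto simp: P_def X_def)
  finally have "?n * ?n / 2 \<le> K * ?n * real (card P)" using Xbig by linarith
  hence "?n \<le> 2 * K * real (card P)" using n2 by (simp add: field_simps)
  moreover have "real (card P) \<le> 3 * real (card ((\<lambda>z. snd z \<otimes> inv (fst z)) ` P))"
  proof (rule card_le_card_image_times[OF fP])
    fix u
    have "{z \<in> P. snd z \<otimes> inv (fst z) = u} =
        {z \<in> A \<times> A. ?f z = v \<and> snd z \<otimes> inv (fst z) = u}" by (auto simp: P_def)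
    thus "real (card {z \<in> P. snd z \<otimes> inv (fst z) = u}) \<le> 3"
      using card_common_ratio_le[OF fin A(1) v0(1), of u] by simp
  qed
  hence "2 * K * real (card P) \<le> 2 * K * (3 * real (card ((\<lambda>z. snd z \<otimes> inv (fst z)) ` P)))"
    using K by (intro mult_left_mono) auto
  ultimately have "?n \<le> 6 * K * real (card ((\<lambda>z. snd z \<otimes> inv (fst z)) ` P))" by linarith
  hence "?n / (6 * K) \<le> real (card ((\<lambda>z. snd z \<otimes> inv (fst z)) ` P))"
    using K by (simp add: pos_divide_le_eq mult_ac)
  thus ?thesis using v0 unfolding P_def by blast
qed

text \<open>
  For \<open>u = d / c\<close> and \<open>u' = d' / c'\<close> one has \<open>u (1 + u') = v d / (c c' c' d')\<close>, because
  \<open>c' d' (c' + d') = v\<close>. Both sets are thus contained in dilates of sets \<open>A\<^sup>m / A\<^sup>n\<close> with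
  \<open>(m, n) = (2, 2)\<close> and \<open>(1, 4)\<close>.
\<close>
lemma ratio_set_bounds:
  assumes A: "finite A" "A \<subseteq> carrier R - {\<zero>}" "A \<noteq> {}"
    and K: "real (card (A <#>\<^bsub>R\<^esub> A)) \<le> K * real (card A)"
    and v: "v \<in> carrier R"
    and U: "U \<subseteq> (\<lambda>z. snd z \<otimes> inv (fst z)) ` {z \<in> A \<times> A. xy_sum R (fst z) (snd z) = v}"
  shows "U \<subseteq> carrier R - {\<zero>}"
    and "real (card (set_div (mult_of R) U U)) \<le> K ^ 4 * real (card A)"
    and "real (card (U <#>\<^bsub>R\<^esub> ((\<lambda>u. \<one> \<oplus> u) ` U))) \<le> K ^ 5 * real (card A)"
proof -
  interpret M: comm_group "mult_of R" by (rule mult_of_comm_group)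
  let ?M = "mult_of R"
  have AM: "A \<subseteq> carrier ?M" using A by simp
  have invM: "m_inv ?M x = inv x" if "x \<in> carrier R - {\<zero>}" for x using m_inv_mult_of that by simp
  have KM: "real (card (A <#>\<^bsub>?M\<^esub> A)) \<le> K * real (card A)" using K by (simp add: set_mult_def)
  have pow_bound: "real (card (set_div ?M (set_pow ?M A m) (set_pow ?M A n))) \<le> K ^ (m + n) * real (card A)" for m n
    by (rule M.pluennecke_ruzsa[OF A(1) AM A(3) A(1) AM KM])
  have I: "inv x \<in> carrier R" "inv x \<noteq> \<zero>" "x \<otimes> inv x = \<one>" "inv x \<otimes> x = \<one>" "x \<in> carrier R" "x \<noteq> \<zero>" if "x \<in> A" for x
  proof -
    have x: "x \<in> Units R" using that A(2) field_Units by blast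
    hence "inv x \<in> Units R" by simp
    thus "inv x \<in> carrier R" "inv x \<noteq> \<zero>" using field_Units by auto
    show "x \<otimes> inv x = \<one>" "inv x \<otimes> x = \<one>" using x by simp_all
    show "x \<in> carrier R" "x \<noteq> \<zero>" using that A(2) by auto
  qed
  have Uform: "\<exists>c\<in>A. \<exists>d\<in>A. u = d \<otimes> inv c \<and> xy_sum R c d = v" if "u \<in> U" for u
    using that U by fastforce
  show "U \<subseteq> carrier R - {\<zero>}"
  proof
    fix u assume "u \<in> U"
    then obtain c d where "c \<in> A" "d \<in> A" "u = d \<otimes> inv c" using Uform by blast
    thus "u \<in> carrier R - {\<zero>}" using I[of c] I[of d] by (simp add: integral_iff)
  qed
  have p1: "set_pow ?M A 1 = A" using M.set_pow_1[OF AM] by simp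
  have p2: "x \<otimes> y \<in> set_pow ?M A 2" if "x \<in> A" "y \<in> A" for x y
    using that M.set_pow_1[OF AM] set_multI[of x A y A ?M] by (simp add: numeral_2_eq_2)
  have p4: "(x \<otimes> y) \<otimes> (z \<otimes> w) \<in> set_pow ?M A 4" if "x \<in> A" "y \<in> A" "z \<in> A" "w \<in> A" for x y z w
    using set_multI[OF p2[OF that(1,2)] p2[OF that(3,4)], of ?M] M.set_pow_add[OF AM, of 2 2] by simp
  have "set_div ?M U U \<subseteq> set_div ?M (set_pow ?M A 2) (set_pow ?M A 2)"
  proof
    fix w assume "w \<in> set_div ?M U U"
    then obtain u u' where uu: "u \<in> U" "u' \<in> U" "w = u \<otimes>\<^bsub>?M\<^esub> m_inv ?M u'" by (rule set_divE)
    obtain c d where cd: "c \<in> A" "d \<in> A" "u = d \<otimes> inv c" using Uform uu by blast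
    obtain c' d' where cd': "c' \<in> A" "d' \<in> A" "u' = d' \<otimes> inv c'" using Uform uu by blast
    have m: "c \<in> carrier ?M" "d \<in> carrier ?M" "c' \<in> carrier ?M" "d' \<in> carrier ?M"
      using cd cd' AM by auto
    have "w = (d \<otimes>\<^bsub>?M\<^esub> m_inv ?M c) \<otimes>\<^bsub>?M\<^esub> m_inv ?M (d' \<otimes>\<^bsub>?M\<^esub> m_inv ?M c')"
      using uu cd cd' I invM by simp
    also have "\<dots> = (d \<otimes>\<^bsub>?M\<^esub> m_inv ?M c) \<otimes>\<^bsub>?M\<^esub> (c' \<otimes>\<^bsub>?M\<^esub> m_inv ?M d')"
      using M.inv_mult[of d' "m_inv ?M c'"] m M.inv_closed[OF m(3)] M.inv_closed[OF m(4)] M.m_comm[of "m_inv ?M d'" c']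
      by (simp only: M.inv_inv)
    also have "\<dots> = (d \<otimes>\<^bsub>?M\<^esub> c') \<otimes>\<^bsub>?M\<^esub> (m_inv ?M c \<otimes>\<^bsub>?M\<^esub> m_inv ?M d')"
      by (rule M.mult_swap) (use m M.inv_closed in blast)+
    also have "\<dots> = (d \<otimes>\<^bsub>?M\<^esub> c') \<otimes>\<^bsub>?M\<^esub> m_inv ?M (c \<otimes>\<^bsub>?M\<^esub> d')"
      using M.inv_mult[OF m(1,4)] by (simp only:)
    also have "\<dots> = (d \<otimes> c') \<otimes>\<^bsub>?M\<^esub> m_inv ?M (c \<otimes> d')" by simp
    finally show "w \<in> set_div ?M (set_pow ?M A 2) (set_pow ?M A 2)"
      using set_divI[OF p2[OF cd(2) cd'(1)] p2[OF cd(1) cd'(2)], of ?M] by (simp only:)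
  qed
  hence "card (set_div ?M U U) \<le> card (set_div ?M (set_pow ?M A 2) (set_pow ?M A 2))"
    using A by (intro card_mono) auto
  thus "real (card (set_div ?M U U)) \<le> K ^ 4 * real (card A)" using pow_bound[of 2 2] by simp
  have "U <#>\<^bsub>R\<^esub> ((\<lambda>u. \<one> \<oplus> u) ` U) \<subseteq> (\<lambda>x. v \<otimes> x) ` set_div ?M (set_pow ?M A 1) (set_pow ?M A 4)"
  proof
    fix w assume "w \<in> U <#>\<^bsub>R\<^esub> ((\<lambda>u. \<one> \<oplus> u) ` U)"
    then obtain u s where us: "u \<in> U" "s \<in> (\<lambda>u. \<one> \<oplus> u) ` U" "w = u \<otimes> s" by (rule set_multE)
    then obtain u' where u': "u' \<in> U" "s = \<one> \<oplus> u'" by blast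
    obtain c d where cd: "c \<in> A" "d \<in> A" "u = d \<otimes> inv c" using Uform us by blast
    obtain c' d' where cd': "c' \<in> A" "d' \<in> A" "u' = d' \<otimes> inv c'" and v': "xy_sum R c' d' = v"
      using Uform u' by blast
    define y where "y = (c \<otimes> c') \<otimes> (c' \<otimes> d')"
    have yp: "y \<in> set_pow ?M A 4" unfolding y_def by (rule p4) (use cd cd' in auto)
    hence yM: "y \<in> carrier R - {\<zero>}" using M.set_pow_closed[OF AM, of 4] by auto
    hence yu: "y \<in> Units R" using field_Units by simp
    have "u \<otimes> c = d" unfolding cd using I cd by (simp add: m_assoc)
    moreover have "u' \<otimes> c' = d'" unfolding cd' using I cd' by (simp add: m_assoc)
    moreover have cl: "u \<in> carrier R" "u' \<in> carrier R" "c \<in> carrier R" "d \<in> carrier R" "c' \<in> carrier R" "d' \<in> carrier R"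
      using us u' cd cd' I by auto
    ultimately have eq: "w \<otimes> y = v \<otimes> d"
    proof -
      assume uc: "u \<otimes> c = d" and uc': "u' \<otimes> c' = d'"
      have "w \<otimes> y = (u \<otimes> c) \<otimes> (c' \<otimes> d') \<otimes> (c' \<oplus> u' \<otimes> c')"
        unfolding us(3) u'(2) y_def using cl by algebra
      also have "\<dots> = d \<otimes> v" unfolding uc uc' v'[symmetric] xy_sum_def using cl by algebra
      finally show ?thesis using cl v by (simp add: m_comm)
    qed
    have wc: "w \<in> carrier R" using us u' cl by simp
    have "w = (w \<otimes> y) \<otimes> inv y" using wc yM yu by (simp add: m_assoc)
    also have "\<dots> = v \<otimes> (d \<otimes> inv y)" unfolding eq using v cl yM yu by (simp add: m_assoc)
    also have "d \<otimes> inv y = d \<otimes>\<^bsub>?M\<^esub> m_inv ?M y" using invM[OF yM] by simp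
    finally show "w \<in> (\<lambda>x. v \<otimes> x) ` set_div ?M (set_pow ?M A 1) (set_pow ?M A 4)"
      using set_divI[of d "set_pow ?M A 1" y "set_pow ?M A 4" ?M] p1 cd yp by blast
  qed
  hence "card (U <#>\<^bsub>R\<^esub> ((\<lambda>u. \<one> \<oplus> u) ` U)) \<le> card (set_div ?M (set_pow ?M A 1) (set_pow ?M A 4))"
    using A by (meson finite_set_div finite_set_pow surj_card_le)
  thus "real (card (U <#>\<^bsub>R\<^esub> ((\<lambda>u. \<one> \<oplus> u) ` U))) \<le> K ^ 5 * real (card A)"
    using pow_bound[of 1 4] by simp
qed

text \<open>
  The ratios of a rich value give \<open>U\<close>, and \<open>U\<close> gives \<open>B\<close> with \<open>|B - B| \<le> L |B|\<close>, where \<open>L\<close> is of the order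
  \<open>K\<^sup>3\<^sup>4\<close>. The number of translates in \<open>sum_product_bound\<close> is then of the order \<open>L K\<^sup>5\<close>, whence
  \<open>N / K\<close> is at most of the order \<open>(L K\<^sup>5)\<^sup>6 L\<^sup>1\<^sup>2 = L\<^sup>1\<^sup>8 K\<^sup>3\<^sup>0\<close>, which is of the order \<open>K\<^sup>6\<^sup>4\<^sup>2\<close>.
\<close>
lemma xy_sum_growth:
  assumes fin: "finite (carrier R)"
    and gen: "\<And>S. S \<subseteq> carrier R \<Longrightarrow> \<zero> \<in> S \<Longrightarrow> (\<And>x. x \<in> S \<Longrightarrow> x \<oplus> \<one> \<in> S) \<Longrightarrow> S = carrier R"
    and A: "A \<subseteq> carrier R - {\<zero>}" "2 \<le> card A" "(card A)\<^sup>2 \<le> card (carrier R)"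
    and F: "real (card (image2 (xy_sum R) A)) \<le> K * real (card A)"
    and P: "real (card (A <#>\<^bsub>R\<^esub> A)) \<le> K * real (card A)"
    and K: "K \<ge> 1"
  shows "real (card A) \<le> 48 * 128 ^ 6 * (2 ^ 25) ^ 18 * K ^ 643"
proof -
  let ?n = "real (card A)"
  have fA: "finite A" and A0: "A \<noteq> {}" using A fin finite_subset by auto
  have n0: "?n > 0" using A by simp
  obtain v where v: "v \<in> carrier R" and rich: "?n / (6 * K) \<le> real (card ((\<lambda>z. snd z \<otimes> inv (fst z)) `
       {z \<in> A \<times> A. xy_sum R (fst z) (snd z) = v}))"
    using exists_rich_value[OF fin A(1,2) F] K by auto
  let ?U0 = "(\<lambda>z. snd z \<otimes> inv (fst z)) ` {z \<in> A \<times> A. xy_sum R (fst z) (snd z) = v}"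
  \<comment> \<open>Cutting \<open>U\<close> down to at most \<open>|A|\<close> elements keeps \<open>|B|\<^sup>2\<close> at most the order of the field.\<close>
  have "min (card ?U0) (card A) \<le> card ?U0" by simp
  then obtain U where U: "U \<subseteq> ?U0" "card U = min (card ?U0) (card A)"
    by (rule obtain_subset_with_card_n)
  have "?n / (6 * K) \<le> ?n / 1" using K n0 by (intro divide_left_mono) auto
  hence Ubig: "?n / (6 * K) \<le> real (card U)" using U rich by (simp add: min_def)
  have "finite {z \<in> A \<times> A. xy_sum R (fst z) (snd z) = v}" using fA by simp
  hence fU: "finite U" using U(1) finite_surj by blast
  have u0: "real (card U) > 0" using Ubig n0 K by (smt (verit) divide_pos_pos)
  hence U0: "U \<noteq> {}" by auto
  note bounds = ratio_set_bounds[OF fA A(1) A0 P v U(1)]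
  have D0: "K ^ 4 * ?n > 0" using K n0 by simp
  obtain B where B: "B \<subseteq> U" "3 / 4 * real (card U) \<le> real (card B)"
    and diff: "real (card (set_div (add_monoid R) B B)) \<le>
        512 * (K ^ 4 * ?n)\<^sup>2 * (K ^ 5 * ?n) ^ 4 / real (card U) ^ 5"
    using subset_with_small_differences[OF fU bounds(1) U0 bounds(2) D0 bounds(3)] by blast
  have "?n / (8 * K) = 3 / 4 * (?n / (6 * K))" by simp
  also have "\<dots> \<le> real (card B)" using B Ubig by linarith
  finally have Bbig: "?n / (8 * K) \<le> real (card B)" .
  have b0: "real (card B) > 0" using B u0 by linarith
  hence B0: "B \<noteq> {}" by auto
  \<comment> \<open>The bound on the differences comes out as \<open>512 \<cdot> 6\<^sup>6 \<cdot> 4/3 \<cdot> K\<^sup>3\<^sup>4\<close> times the lower bound for \<open>|B|\<close>,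
    and the numerical factor is below \<open>2\<^sup>2\<^sup>5\<close>.\<close>
  define L where "L = 2 ^ 25 * K ^ 34"
  have L0: "L \<ge> 0" using K by (simp add: L_def)
  define w where "w = ?n / (6 * K)"
  have w0: "w > 0" and nw: "?n = 6 * K * w" using K n0 by (simp_all add: w_def)
  have wU: "w \<le> real (card U)" using Ubig by (simp add: w_def)
  have expand: "512 * (K ^ 4 * ?n)\<^sup>2 * (K ^ 5 * ?n) ^ 4 = 512 * 6 ^ 6 * K ^ 34 * w * w ^ 5"
    unfolding nw by Groebner_Basis.algebra
  have "512 * (K ^ 4 * ?n)\<^sup>2 * (K ^ 5 * ?n) ^ 4 / real (card U) ^ 5
      \<le> 512 * (K ^ 4 * ?n)\<^sup>2 * (K ^ 5 * ?n) ^ 4 / w ^ 5"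
  proof (rule divide_left_mono)
    show "w ^ 5 \<le> real (card U) ^ 5" using wU w0 by (intro power_mono) auto
    show "0 < real (card U) ^ 5 * w ^ 5" using u0 w0 by (intro mult_pos_pos zero_less_power)
    show "0 \<le> 512 * (K ^ 4 * ?n)\<^sup>2 * (K ^ 5 * ?n) ^ 4"
      using K n0 by (intro mult_nonneg_nonneg zero_le_power) auto
  qed
  also have "\<dots> = 512 * 6 ^ 6 * K ^ 34 * w"
    unfolding expand using w0 by simp
  also have "\<dots> \<le> L * (3 / 4 * w)" using w0 K by (simp add: L_def)
  also have "\<dots> \<le> L * real (card B)" using B wU L0 by (intro mult_left_mono) auto
  finally have small: "real (card (set_div (add_monoid R) B B)) \<le> L * real (card B)" using diff by linarith
  have quot: "real (card (set_div (mult_of R) B B)) \<le> K ^ 4 * ?n"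
  proof -
    have "card (set_div (mult_of R) B B) \<le> card (set_div (mult_of R) U U)"
      using fU B by (intro card_mono set_div_mono) auto
    thus ?thesis using bounds(2) by linarith
  qed
  have "card B \<le> card A" using card_mono[OF fU B(1)] U by simp
  hence Bp: "(card B)\<^sup>2 \<le> card (carrier R)" using A(3) by (meson order_trans power_mono zero_le)
  have BR: "B \<subseteq> carrier R - {\<zero>}" using B bounds(1) by blast
  have "real (card B) \<le> 6 * (16 * L * (K ^ 4 * ?n) / real (card B)) ^ 6 * L ^ 12"
  proof (rule sum_product_bound)
    show "S = carrier R" if "S \<subseteq> carrier R" "\<zero> \<in> S" "\<And>x. x \<in> S \<Longrightarrow> x \<oplus> \<one> \<in> S" for S
      using that by (rule gen)
  qed fact+
  with Bbig have "?n / (8 * K) \<le> 6 * (16 * L * (K ^ 4 * ?n) / real (card B)) ^ 6 * L ^ 12"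
    by linarith
  also have "\<dots> \<le> 6 * (128 * L * K ^ 5) ^ 6 * L ^ 12"
  proof -
    have "16 * L * (K ^ 4 * ?n) / real (card B) \<le> 16 * L * (K ^ 4 * ?n) / (?n / (8 * K))"
      using Bbig L0 D0 n0 K b0 by (intro divide_left_mono) auto
    also have "\<dots> = 128 * L * K ^ 5" using n0 K by (simp add: field_simps eval_nat_numeral)
    finally have "(16 * L * (K ^ 4 * ?n) / real (card B)) ^ 6 \<le> (128 * L * K ^ 5) ^ 6"
      using L0 D0 b0 by (intro power_mono divide_nonneg_nonneg mult_nonneg_nonneg) auto
    thus ?thesis using L0 by (intro mult_right_mono mult_left_mono) auto
  qed
  also have "\<dots> = 6 * 128 ^ 6 * (L ^ 18 * K ^ 30)" by Groebner_Basis.algebra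
  also have "L ^ 18 * K ^ 30 = (2 ^ 25) ^ 18 * K ^ 642"
    unfolding L_def
    by (simp only: power_mult_distrib power_mult[symmetric] mult.assoc power_add[symmetric]) simp
  finally have "?n / (8 * K) * (8 * K) \<le> 6 * 128 ^ 6 * ((2 ^ 25) ^ 18 * K ^ 642) * (8 * K)"
    using K by (intro mult_right_mono) auto
  also have "?n / (8 * K) * (8 * K) = ?n" using K by simp
  also have "6 * 128 ^ 6 * ((2 ^ 25) ^ 18 * K ^ 642) * (8 * K) = 48 * 128 ^ 6 * (2 ^ 25) ^ 18 * (K ^ 642 * K)"
    by simp
  also have "K ^ 642 * K = K ^ 643" by (metis Suc_numeral power_Suc2 semiring_norm(5))
  finally show ?thesis .
qed

end

lemma (in residues_prime) carrier_generated_by_one: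
  assumes S: "S \<subseteq> carrier R" "\<zero> \<in> S" "\<And>x. x \<in> S \<Longrightarrow> x \<oplus> \<one> \<in> S"
  shows "S = carrier R"
proof -
  have "n < p \<Longrightarrow> int n \<in> S" for n :: nat
  proof (induction n)
    case 0
    show ?case using S(2) by (simp add: res_zero_eq)
  next
    case (Suc n)
    hence "int n \<oplus> \<one> \<in> S" using S(3) by simp
    also have "int n \<oplus> \<one> = int (Suc n)" using Suc.prems by (simp add: res_add_eq res_one_eq)
    finally show ?case .
  qed
  moreover have "x = int (nat x)" "nat x < p" if "x \<in> carrier R" for x
    using that by (auto simp: res_carrier_eq nat_less_iff)
  ultimately have "x \<in> S" if "x \<in> carrier R" for x using that by metis
  thus ?thesis using S(1) by blast
qed

theorem theorem6p3:
  shows "\<exists>\<kappa>::real. \<kappa> > 0 \<and>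
    (\<forall>(p::nat) (A::int set).
       prime p \<longrightarrow>
       A \<subseteq> carrier (residue_ring (int p)) - {\<zero>\<^bsub>residue_ring (int p)\<^esub>} \<longrightarrow>
       real (card A) \<le> real p powr (1/2 - 1/500) \<longrightarrow>
       max (real (card (image2 (xy_sum (residue_ring (int p))) A)))
           (real (card (A <#>\<^bsub>residue_ring (int p)\<^esub> A)))
         \<ge> \<kappa> * real (card A) powr (1 + 1/800))"
proof -
  define C :: real where "C = 48 * 128 ^ 6 * (2 ^ 25) ^ 18"
  have C1: "C \<ge> 1" by (simp add: C_def)
  have "(1 / C) * real (card A) powr (1 + 1/800) \<le>
       max (real (card (image2 (xy_sum (residue_ring (int p))) A)))
           (real (card (A <#>\<^bsub>residue_ring (int p)\<^esub> A)))"
    if p: "prime p" and A: "A \<subseteq> carrier (residue_ring (int p)) - {\<zero>\<^bsub>residue_ring (int p)\<^esub>}"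
      and small: "real (card A) \<le> real p powr (1/2 - 1/500)" for p :: nat and A :: "int set"
  proof (cases "card A = 0")
    case False
    define R where "R = residue_ring (int p)"
    interpret residues_prime p R by unfold_locales (use p in \<open>auto simp: R_def\<close>)
    let ?n = "real (card A)"
    let ?m = "max (real (card (image2 (xy_sum R) A))) (real (card (A <#>\<^bsub>R\<^esub> A)))"
    define K where "K = ?m / ?n"
    have n0: "?n > 0" using False by simp
    have mK: "?m = K * ?n" using n0 by (simp add: K_def)
    have AR: "A \<subseteq> carrier R - {\<zero>\<^bsub>R\<^esub>}" using A unfolding R_def .
    have fA: "finite A" by (rule card_ge_0_finite) (use False in simp)
    have "card A \<le> card (A <#>\<^bsub>mult_of R\<^esub> A)"
      by (rule comm_group.card_le_card_set_mult[OF mult_of_comm_group]) (use AR fA False in auto)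
    hence "card A \<le> card (A <#>\<^bsub>R\<^esub> A)" by (simp add: set_mult_def)
    hence "?n \<le> ?m" by simp
    hence "?n \<le> K * ?n" using mK by simp
    hence K1: "K \<ge> 1" using n0 by simp
    have "?n \<le> C * K ^ 643"
    proof (cases "card A = 1")
      case True
      have "1 \<le> C * K ^ 643" using C1 K1 mult_mono[of 1 C 1 "K ^ 643"] by simp
      thus ?thesis using True by simp
    next
      case False
      hence two: "2 \<le> card A" using \<open>card A \<noteq> 0\<close> by linarith
      have p1: "real p \<ge> 1" using p prime_ge_1_nat by simp
      have "?n \<le> real p powr (1/2)" using small powr_mono[of "1/2 - 1/500" "1/2" "real p"] p1 by simp
      also have "\<dots> = sqrt (real p)" using p1 by (simp add: powr_half_sqrt)
      finally have "?n\<^sup>2 \<le> (sqrt (real p))\<^sup>2" by (intro power_mono) auto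
      hence "real ((card A)\<^sup>2) \<le> real p" by simp
      hence "(card A)\<^sup>2 \<le> p" by (simp only: of_nat_le_iff)
      moreover have "card (carrier R) = p" by (simp add: res_carrier_eq)
      ultimately show ?thesis
        unfolding C_def
      proof (intro xy_sum_growth)
        show "real (card (image2 (xy_sum R) A)) \<le> K * ?n" "real (card (A <#>\<^bsub>R\<^esub> A)) \<le> K * ?n"
          unfolding mK[symmetric] by simp_all
        show "S = carrier R"
          if "S \<subseteq> carrier R" "\<zero>\<^bsub>R\<^esub> \<in> S" "\<And>x. x \<in> S \<Longrightarrow> x \<oplus>\<^bsub>R\<^esub> \<one>\<^bsub>R\<^esub> \<in> S" for S
          using that by (rule carrier_generated_by_one)
        show "A \<subseteq> carrier R - {\<zero>\<^bsub>R\<^esub>}" by (fact AR)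
      qed (use two K1 in simp_all)
    qed
    also have "\<dots> \<le> C ^ 800 * K ^ 800"
    proof (rule mult_mono)
      show "C \<le> C ^ 800" using C1 by (rule self_le_power) simp
      show "K ^ 643 \<le> K ^ 800" using K1 by (intro power_increasing) simp_all
    qed (use C1 K1 in simp_all)
    also have "\<dots> = (C * K) ^ 800" by (simp only: power_mult_distrib)
    also have "\<dots> = (C * K) powr 800" using C1 K1 powr_realpow[of "C * K" 800] by simp
    finally have "?n powr (1/800) \<le> ((C * K) powr 800) powr (1/800)"
      using n0 by (intro powr_mono2) auto
    also have "\<dots> = C * K" unfolding powr_powr using C1 K1 by simp
    finally have "?n * ?n powr (1/800) \<le> ?n * (C * K)" using n0 by (intro mult_left_mono) auto
    also have "?n * ?n powr (1/800) = ?n powr (1 + 1/800)" by (subst powr_add) (use n0 in simp)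
    also have "?n * (C * K) = C * ?m" unfolding mK by (simp only: mult_ac)
    finally have "?n powr (1 + 1/800) \<le> C * ?m" .
    hence "(1 / C) * ?n powr (1 + 1/800) \<le> ?m" using C1 by (simp add: field_simps)
    thus ?thesis by (simp add: R_def)
  qed simp
  moreover have "1 / C > 0" using C1 by simp
  ultimately show ?thesis by blast
qed

end
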